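(* A functional $Z\colon \mathrm{Conv}(\mathbb{R};\mathbb{R})\to\mathbb{R}$ is a continuous and dually epi-translation invariant valuation if and only if there exist a constant $\zeta_0\in\mathbb{R}$ and a function $\zeta_1\in C_c(\mathbb{R})$ such that $$Z(v)=\zeta_0+\int_{\mathbb{R}\times\mathbb{R}}\zeta_1(x)\,d\Theta_0(v,(x,y))$$ for every $v\in\mathrm{Conv}(\mathbb{R};\mathbb{R})$.
   Context: $\mathrm{Conv}(\mathbb{R};\mathbb{R})$ is the set of convex functions $v\colon\mathbb{R}\to\mathbb{R}$ (finite everywhere). Topology: continuity is with respect to epi-convergence. A sequence $v_k$ epi-converges to $v$ if for every $x\in\mathbb{R}$: (i) $v(x)\le\liminf_{k\to\infty}v_k(x_k)$ for every sequence $x_k\to x$, and (ii) there is a sequence $x_k\to x$ with $v(x)=\lim_{k\to\infty}v_k(x_k)$. (On $\mathrm{Conv}(\mathbb{R};\mathbb{R})$ this is equivalent to uniform convergence on compact sets.) A functional $Z\colon X\to\mathbb{R}$ on a set $X$ of functions is a valuation if $Z(u\vee v)+Z(u\wedge v)=Z(u)+Z(v)$ for all $u,v\in X$ with $u\vee v\in X$ and $u\wedge v\in X$, where $\vee$ and $\wedge$ denote pointwise maximum and minimum. $Z$ is dually epi-translation invariant if $Z(v+\ell)=Z(v)$ for every $v$ and every linear function $\ell\colon\mathbb{R}\to\mathbb{R}$ and $Z(v+\alpha)=Z(v)$ for every $v$ and every constant $\alpha\in\mathbb{R}$. Hessian measures in dimension one: let $\partial v(x)=\{y\in\mathbb{R}: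 v(z)\ge v(x)+(z-x)y\ \forall z\in\mathbb{R}\}$ and $\Gamma_v=\{(x,y)\in\mathbb{R}^2: y\in\partial v(x)\}$. For a Borel set $\eta\subset\mathbb{R}\times\mathbb{R}$ and $s>0$ let $P_s(v,\eta)=\{x+sy:(x,y)\in\Gamma_v\cap\eta\}$. This set is measurable and its Lebesgue measure is a polynomial in $s$ with non-negative coefficients, $\mathcal{H}^1(P_s(v,\eta))=\Theta_1(v,\eta)+s\,\Theta_0(v,\eta)$; this defines the non-negative Borel measures $\Theta_0(v,\cdot),\Theta_1(v,\cdot)$ on $\mathbb{R}\times\mathbb{R}$. $C_c(\mathbb{R})$ is the set of continuous real-valued functions on $\mathbb{R}$ with compact support. *)

theory Defs
  imports "HOL-Analysis.Analysis"
begin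

text \<open>
  Functionals on a set \<open>X\<close> of functions are modelled as total functions
  \<open>(real \<Rightarrow> real) \<Rightarrow> real\<close>; every property below constrains them only on \<open>X\<close>.
\<close>

definition Conv :: "(real \<Rightarrow> real) set" where
  "Conv = {v. convex_on UNIV v}"

text \<open>The lower limit is taken in \<^typ>\<open>ereal\<close>, since it may be infinite a priori.\<close>

definition epi_converges :: "(nat \<Rightarrow> real \<Rightarrow> real) \<Rightarrow> (real \<Rightarrow> real) \<Rightarrow> bool" where
  "epi_converges vs v \<longleftrightarrow>
     (\<forall>x. (\<forall>xs. xs \<longlonglongrightarrow> x \<longrightarrow> ereal (v x) \<le> liminf (\<lambda>k. ereal (vs k (xs k)))) \<and>
          (\<exists>xs. xs \<longlonglongrightarrow> x \<and> (\<lambda>k. vs k (xs k)) \<longlonglongrightarrow> v x))"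

text \<open>
  Epi-convergence on \<^const>\<open>Conv\<close> is uniform convergence on compact sets, which is metrizable,
  so continuity is sequential continuity.
\<close>

definition epi_continuous_on :: "(real \<Rightarrow> real) set \<Rightarrow> ((real \<Rightarrow> real) \<Rightarrow> real) \<Rightarrow> bool" where
  "epi_continuous_on X Z \<longleftrightarrow>
     (\<forall>vs. \<forall>v\<in>X. (\<forall>k. vs k \<in> X) \<longrightarrow> epi_converges vs v \<longrightarrow> (\<lambda>k. Z (vs k)) \<longlonglongrightarrow> Z v)"

definition valuation_on :: "(real \<Rightarrow> real) set \<Rightarrow> ((real \<Rightarrow> real) \<Rightarrow> real) \<Rightarrow> bool" where
  "valuation_on X Z \<longleftrightarrow>
     (\<forall>u\<in>X. \<forall>v\<in>X. (\<lambda>x. max (u x) (v x)) \<in> X \<longrightarrow> (\<lambda>x. min (u x) (v x)) \<in> X \<longrightarrow>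
        Z (\<lambda>x. max (u x) (v x)) + Z (\<lambda>x. min (u x) (v x)) = Z u + Z v)"

definition dually_epi_translation_invariant :: "((real \<Rightarrow> real) \<Rightarrow> real) \<Rightarrow> bool" where
  "dually_epi_translation_invariant Z \<longleftrightarrow>
     (\<forall>v\<in>Conv. \<forall>l. linear l \<longrightarrow> Z (\<lambda>x. v x + l x) = Z v) \<and>
     (\<forall>v\<in>Conv. \<forall>\<alpha>. Z (\<lambda>x. v x + \<alpha>) = Z v)"

definition subdifferential :: "(real \<Rightarrow> real) \<Rightarrow> real \<Rightarrow> real set" where
  "subdifferential v x = {y. \<forall>z. v z \<ge> v x + (z - x) * y}"

definition subdiff_graph :: "(real \<Rightarrow> real) \<Rightarrow> (real \<times> real) set" where
  "subdiff_graph v = {(x, y). y \<in> subdifferential v x}"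

definition P_set :: "real \<Rightarrow> (real \<Rightarrow> real) \<Rightarrow> (real \<times> real) set \<Rightarrow> real set" where
  "P_set s v \<eta> = (\<lambda>(x, y). x + s * y) ` (subdiff_graph v \<inter> \<eta>)"

definition is_hessian_measures ::
    "(real \<Rightarrow> real) \<Rightarrow> (real \<times> real) measure \<Rightarrow> (real \<times> real) measure \<Rightarrow> bool" where
  "is_hessian_measures v T0 T1 \<longleftrightarrow>
     sets T0 = sets borel \<and> sets T1 = sets borel \<and>
     (\<forall>\<eta>\<in>sets borel. \<forall>s>0.
        emeasure lebesgue (P_set s v \<eta>) = emeasure T1 \<eta> + ennreal s * emeasure T0 \<eta>)"

text \<open>
  For convex \<open>v\<close> the pair of measures exists and is unique: on bounded Borel sets both sides
  are finite, so the coefficients are determined there, and hence so are the measures.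
  On unbounded sets (e.g. \<^term>\<open>UNIV\<close>) the polynomial alone may be infinite and determine nothing,
  which is why the coefficients are specified as measures and not set by set.
\<close>

definition hessian_measure0 :: "(real \<Rightarrow> real) \<Rightarrow> (real \<times> real) measure" where
  "hessian_measure0 v = (THE T0. \<exists>T1. is_hessian_measures v T0 T1)"

definition Cc :: "(real \<Rightarrow> real) set" where
  "Cc = {f. continuous_on UNIV f \<and> compact (closure {x. f x \<noteq> 0})}"

end

theory Submission
  imports Defs
begin

text \<open>
  By Minty's parametrization, every \<open>t\<close> is uniquely \<open>x + y\<close> with \<open>y \<in> \<partial>v(x)\<close>; put
  \<open>prox v t = x\<close>. Both \<open>x\<close> and \<open>y\<close> are continuous and nondecreasing in \<open>t\<close>, and
  \<open>\<Theta>\<^sub>1\<close>, \<open>\<Theta>\<^sub>0\<close> are the images of the Stieltjes measures \<open>dx\<close>, \<open>dy\<close> under \<open>t \<mapsto> (x, y)\<close>.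
  Since \<open>dx + dy = dt\<close> and \<open>x\<close> maps \<open>dx\<close> to Lebesgue measure,
  \<open>\<integral> \<zeta>(x) d\<Theta>\<^sub>0(v, (x, y)) = \<integral> \<zeta>(prox v t) dt - \<integral> \<zeta>(t) dt\<close>.
  Continuity, invariance and the valuation property then hold already for the integrand:
  epi-convergence makes the proximal maps converge, a linear summand shifts them, and for \<open>u\<close>, \<open>v\<close> with
  convex minimum the proximal points of maximum and minimum are those of \<open>u\<close> and \<open>v\<close> up to order.

  Conversely, the valuation property splits off the last kink of a piecewise affine function, so a
  functional as in the theorem is determined by its values at \<open>0\<close> and at the hinges
  \<open>z \<mapsto> max 0 (z - x)\<close>, piecewise affine interpolants being dense. The density is
  \<open>\<zeta>\<^sub>1(x) = Z(hinge x) - Z(0)\<close>; if it did not vanish along some \<open>|x| \<rightarrow> \<infinity>\<close>, rescaled hinges would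
  converge to \<open>0\<close> (after subtracting an affine function) without their values converging.
\<close>

subsection \<open>Convex functions on the line\<close>

text \<open>Beyond \<open>x\<close>, a convex function lies above the line that extends the chord
  from the unit neighbour of \<open>x\<close> on the other side. The slope bound is explicit in
  three values of \<open>v\<close>, so it survives pointwise limits; it also gives the coercivity
  that minimization requires.\<close>

lemma Conv_affine_below:
  assumes "v \<in> Conv"
  shows "v z \<ge> v x - (\<bar>v x - v (x - 1)\<bar> + \<bar>v (x + 1) - v x\<bar>) * \<bar>z - x\<bar>"
proof -
  have v: "convex_on UNIV v"
    using assms by (simp add: Conv_def)
  \<comment> \<open>Here \<open>e\<close> is the direction from \<open>x\<close> to \<open>z\<close>
    and \<open>d\<close> the distance, so that \<open>x\<close> is the convex combination of
    \<open>z\<close> and \<open>x - e\<close> with weights \<open>1 / (1 + d)\<close> and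
    \<open>d / (1 + d)\<close>.\<close>
  have *: "v z \<ge> v x - d * \<bar>v (x - e) - v x\<bar>"
    if "d > 0" "\<bar>e\<bar> = 1" "z = x + d * e" for d e
  proof -
    have "x = (1 - d / (1 + d)) *\<^sub>R z + (d / (1 + d)) *\<^sub>R (x - e)"
      using that by (simp add: divide_simps) (simp add: algebra_simps)
    then have "v x \<le> (1 - d / (1 + d)) * v z + (d / (1 + d)) * v (x - e)"
      using convex_onD[OF v, of "d / (1 + d)" z "x - e"] that by simp
    then have "(1 + d) * v x \<le> (1 + d) * ((1 - d / (1 + d)) * v z + (d / (1 + d)) * v (x - e))"
      using that by (intro mult_left_mono) auto
    also have "1 - d / (1 + d) = 1 / (1 + d)"
      using that by (simp add: field_simps)
    also have "(1 + d) * (1 / (1 + d) * v z + d / (1 + d) * v (x - e)) = v z + d * v (x - e)"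
      using that by (simp add: distrib_left)
    finally have "v z \<ge> v x - d * (v (x - e) - v x)"
      by (simp add: algebra_simps)
    moreover have "d * (v (x - e) - v x) \<le> d * \<bar>v (x - e) - v x\<bar>"
      using that by (intro mult_left_mono) auto
    ultimately show ?thesis by linarith
  qed
  consider "z = x" | "z > x" | "z < x" by linarith
  then show ?thesis
  proof cases
    case 2
    have "0 \<le> (z - x) * \<bar>v (x + 1) - v x\<bar>" using 2 by simp
    with *[of "z - x" 1] 2 show ?thesis by (simp add: algebra_simps abs_minus_commute)
  next
    case 3
    have "0 \<le> (x - z) * \<bar>v (x - 1) - v x\<bar>" using 3 by simp
    with *[of "x - z" "-1"] 3 show ?thesis by (simp add: algebra_simps abs_minus_commute)
  qed auto
qed

lemma Conv_continuous: "v \<in> Conv \<Longrightarrow> continuous_on UNIV v"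
  by (simp add: Conv_def convex_on_continuous)

text \<open>The witness is the right derivative, the infimum of the difference quotients towards
  points to the right of \<open>x\<close>.\<close>

lemma subdifferential_nonempty:
  assumes "v \<in> Conv"
  shows "\<exists>y. y \<in> subdifferential v x"
  using convex_le_Inf_differential[of UNIV v x] assms
  unfolding Conv_def subdifferential_def
  by (intro exI[of _ "Inf ((\<lambda>t. (v x - v t) / (x - t)) ` ({x<..} \<inter> UNIV))"])
    (auto simp: mult.commute)

lemma subdifferential_mono:
  assumes "y \<in> subdifferential v x" "y' \<in> subdifferential v x'"
  shows "(x' - x) * (y' - y) \<ge> 0"
proof -
  have "v x' \<ge> v x + (x' - x) * y" "v x \<ge> v x' + (x - x') * y'"
    using assms by (auto simp: subdifferential_def)
  then show ?thesis by (simp add: algebra_simps)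
qed

text \<open>The segment from \<open>x\<close> to \<open>z\<close> starts inside \<open>U\<close>.
  The inequality holds at \<open>x + l * (z - x)\<close> for small \<open>l\<close>, and convexity
  along the segment carries it to \<open>z\<close> after division by \<open>l\<close>.\<close>

lemma local_subgradient_imp_subdifferential:
  assumes v: "v \<in> Conv" and "open U" "x \<in> U"
    and loc: "\<And>z. z \<in> U \<Longrightarrow> v z \<ge> v x + (z - x) * y"
  shows "y \<in> subdifferential v x"
  unfolding subdifferential_def
proof safe
  fix z
  obtain e where e: "e > 0" "\<And>w. \<bar>w - x\<bar> < e \<Longrightarrow> w \<in> U"
    using \<open>open U\<close> \<open>x \<in> U\<close> by (auto simp: open_dist dist_real_def)
  have pos: "\<bar>z - x\<bar> + 1 > 0" by simp
  define l where "l = min 1 (e / 2 / (\<bar>z - x\<bar> + 1))"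
  have l: "0 < l" "l \<le> 1"
    using e by (auto simp: l_def intro!: divide_pos_pos add_nonneg_pos)
  have "l * \<bar>z - x\<bar> \<le> e / 2 / (\<bar>z - x\<bar> + 1) * \<bar>z - x\<bar>"
    by (intro mult_right_mono) (auto simp: l_def)
  also have "\<dots> \<le> e / 2"
    using e pos by (simp only: times_divide_eq_left pos_divide_le_eq) (simp add: algebra_simps)
  finally have "x + l * (z - x) \<in> U"
    using e l by (intro e(2)) (auto simp: abs_mult)
  then have "v x + l * (z - x) * y \<le> v (x + l * (z - x))"
    using loc[of "x + l * (z - x)"] by simp
  also have "x + l * (z - x) = (1 - l) *\<^sub>R x + l *\<^sub>R z" by (simp add: algebra_simps)
  also have "v \<dots> \<le> (1 - l) * v x + l * v z"
    using convex_onD[of UNIV v l x z] v l by (simp add: Conv_def)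
  finally have "l * (v x + (z - x) * y) \<le> l * v z" by (simp add: algebra_simps)
  then show "v x + (z - x) * y \<le> v z" using l by simp
qed

subsection \<open>The proximal map\<close>

text \<open>The resolvent of the subdifferential, inverse to \<open>id\<close> plus the
  subdifferential; \<open>prox v t\<close> minimizes \<open>v z + (z - t)^2 / 2\<close> over
  \<open>z\<close>. For convex \<open>v\<close> existence and uniqueness are
  \<open>resolvent_exists\<close> and \<open>prox_eqI\<close>.\<close>

definition prox :: "(real \<Rightarrow> real) \<Rightarrow> real \<Rightarrow> real" where
  "prox v t = (THE x. t - x \<in> subdifferential v x)"

text \<open>The increments of \<open>x\<close> and of \<open>t - x\<close> have a nonnegative
  product because the subdifferential is monotone, and a nonnegative sum \<open>t' - t\<close>;
  hence neither is negative.\<close>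

lemma resolvent_mono:
  assumes "t - x \<in> subdifferential v x" "t' - x' \<in> subdifferential v x'" "t \<le> t'"
  shows "x \<le> x'" and "t - x \<le> t' - x'"
proof -
  have *: "(x' - x) * ((t' - x') - (t - x)) \<ge> 0"
    using subdifferential_mono assms by blast
  show "x \<le> x'" using * assms(3) by (auto simp: zero_le_mult_iff)
  show "t - x \<le> t' - x'" using * assms(3) by (auto simp: zero_le_mult_iff)
qed

text \<open>First-order condition at a minimizer: compare \<open>p\<close> with
  \<open>p + l * (z - p)\<close>, divide by \<open>l\<close>, and let \<open>l\<close> tend to
  \<open>0\<close> from the right, which removes the quadratic remainder.\<close>

lemma subdifferential_of_prox_min:
  assumes v: "v \<in> Conv"
    and min: "\<And>z. v p + (p - t)\<^sup>2 / 2 \<le> v z + (z - t)\<^sup>2 / 2"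
  shows "t - p \<in> subdifferential v p"
  unfolding subdifferential_def
proof safe
  fix z
  have *: "v p + (z - p) * (t - p) - l * ((z - p)\<^sup>2 / 2) \<le> v z" if l: "0 < l" "l \<le> 1" for l
  proof -
    have "v p + (p - t)\<^sup>2 / 2 \<le> v (p + l * (z - p)) + (p + l * (z - p) - t)\<^sup>2 / 2"
      using min[of "p + l * (z - p)"] by simp
    also have "v (p + l * (z - p)) = v ((1 - l) *\<^sub>R p + l *\<^sub>R z)" by (simp add: algebra_simps)
    also have "\<dots> \<le> (1 - l) * v p + l * v z"
      using convex_onD[of UNIV v l p z] v l by (simp add: Conv_def)
    finally have "l * (v p + (z - p) * (t - p) - l * ((z - p)\<^sup>2 / 2)) \<le> l * v z"
      by (simp add: power2_eq_square algebra_simps add_divide_distrib diff_divide_distrib)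
    then show ?thesis using l by simp
  qed
  have "((\<lambda>l. v p + (z - p) * (t - p) - l * ((z - p)\<^sup>2 / 2))
      \<longlongrightarrow> v p + (z - p) * (t - p) - 0 * ((z - p)\<^sup>2 / 2)) (at_right 0)"
    by (intro tendsto_intros)
  moreover have "\<forall>\<^sub>F l in at_right 0. v p + (z - p) * (t - p) - l * ((z - p)\<^sup>2 / 2) \<le> v z"
    using * by (auto simp: eventually_at_right_field intro!: exI[of _ 1])
  ultimately show "v p + (z - p) * (t - p) \<le> v z"
    using tendsto_upperbound by fastforce
qed

text \<open>A minimizer of \<open>f\<close> exists on a compact interval. At distance at least
  \<open>2 * C\<close> from \<open>t\<close> the quadratic term outweighs the linear lower bound of
  slope \<open>C\<close>, so that the minimum is global.\<close>

lemma resolvent_exists: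
  assumes v: "v \<in> Conv"
  shows "\<exists>x. t - x \<in> subdifferential v x"
proof -
  define f where "f x = v x + (x - t)\<^sup>2 / 2" for x
  define C where "C = \<bar>v t - v (t - 1)\<bar> + \<bar>v (t + 1) - v t\<bar>"
  have C: "C \<ge> 0" by (simp add: C_def)
  have cont: "continuous_on {t - 2 * C..t + 2 * C} f"
    unfolding f_def using Conv_continuous[OF v]
    by (intro continuous_intros) (auto intro: continuous_on_subset)
  obtain p where p: "p \<in> {t - 2 * C..t + 2 * C}" "\<And>z. z \<in> {t - 2 * C..t + 2 * C} \<Longrightarrow> f p \<le> f z"
    using continuous_attains_inf[OF compact_Icc _ cont] C by auto
  have min: "f p \<le> f z" for z
  proof (cases "z \<in> {t - 2 * C..t + 2 * C}")
    case False
    then have "\<bar>z - t\<bar> \<ge> 2 * C" by auto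
    then have "\<bar>z - t\<bar> * (\<bar>z - t\<bar> / 2 - C) \<ge> 0" by (intro mult_nonneg_nonneg) auto
    then have "(z - t)\<^sup>2 / 2 \<ge> C * \<bar>z - t\<bar>" by (simp add: algebra_simps power2_eq_square)
    then have "f z \<ge> v t"
      using Conv_affine_below[OF v, where x=t and z=z] by (simp add: f_def C_def)
    moreover have "f p \<le> f t" using p C by auto
    ultimately show ?thesis by (simp add: f_def)
  qed (use p in auto)
  have "t - p \<in> subdifferential v p"
    using min by (intro subdifferential_of_prox_min[OF v]) (simp add: f_def)
  then show ?thesis by blast
qed

lemma prox_eqI:
  assumes "t - x \<in> subdifferential v x"
  shows "prox v t = x"
  unfolding prox_def
proof (rule the_equality)
  show "t - x \<in> subdifferential v x" by fact
next
  fix x' assume "t - x' \<in> subdifferential v x'"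
  then show "x' = x" using resolvent_mono(1)[of t] assms by (meson antisym order_refl)
qed

lemma prox_subgradient: "v \<in> Conv \<Longrightarrow> t - prox v t \<in> subdifferential v (prox v t)"
  using resolvent_exists prox_eqI by metis

lemma prox_mono: "v \<in> Conv \<Longrightarrow> mono (prox v)"
  using resolvent_mono(1) prox_subgradient by (meson monoI)

lemma prox_compl_mono: "v \<in> Conv \<Longrightarrow> mono (\<lambda>t. t - prox v t)"
  using resolvent_mono(2) prox_subgradient by (meson monoI)

text \<open>The increments of \<open>prox v t\<close> and \<open>t - prox v t\<close> are
  nonnegative and add up to that of \<open>t\<close>, so each is at most that of
  \<open>t\<close>.\<close>

lemma prox_continuous:
  assumes "v \<in> Conv"
  shows "continuous_on A (prox v)"
proof -
  have "1-lipschitz_on A (prox v)"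
  proof (rule lipschitz_onI)
    fix s t
    show "dist (prox v s) (prox v t) \<le> 1 * dist s t"
      using monoD[OF prox_mono[OF assms], of s t] monoD[OF prox_mono[OF assms], of t s]
        monoD[OF prox_compl_mono[OF assms], of s t] monoD[OF prox_compl_mono[OF assms], of t s]
      by (cases "s \<le> t") (auto simp: dist_real_def)
  qed auto
  then show ?thesis by (rule lipschitz_on_continuous_on)
qed

lemma prox_surj:
  assumes "v \<in> Conv"
  shows "surj (prox v)"
proof -
  have "\<exists>t. prox v t = x" for x
    using subdifferential_nonempty[OF assms, of x] prox_eqI[of _ x v]
    by (metis add_diff_cancel)
  then show ?thesis by (metis surjI)
qed

lemma subdiff_graph_eq_prox:
  assumes "v \<in> Conv"
  shows "subdiff_graph v = range (\<lambda>t. (prox v t, t - prox v t))"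
proof -
  have "(x, y) \<in> range (\<lambda>t. (prox v t, t - prox v t))" if "y \<in> subdifferential v x" for x y
    using prox_eqI[of "x + y" x v] that by (intro image_eqI[of _ _ "x + y"]) auto
  then show ?thesis
    using prox_subgradient[OF assms] by (auto simp: subdiff_graph_def)
qed

subsection \<open>Stieltjes measures\<close>

lemma emeasure_interval_measure_Ioo:
  assumes "a \<le> b" and mono: "mono F" and cont: "continuous_on UNIV F"
  shows "emeasure (interval_measure F) {a<..<b} = F b - F a"
proof (cases "a = b")
  case False
  have m: "\<And>x y. x \<le> y \<Longrightarrow> F x \<le> F y" using mono by (rule monoD)
  have null: "{a, b} \<in> null_sets (interval_measure F)"
    using emeasure_interval_measure_Icc[OF order_refl m cont, of a]
      emeasure_interval_measure_Icc[OF order_refl m cont, of b]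
    by (subst insert_is_Un) (intro null_sets.Un; simp add: null_sets_def)
  have "emeasure (interval_measure F) {a<..<b} = emeasure (interval_measure F) ({a<..<b} \<union> {a, b})"
    by (subst emeasure_Un_null_set[OF _ null]) auto
  also have "{a<..<b} \<union> {a, b} = {a..b}" using assms(1) False by auto
  finally show ?thesis using emeasure_interval_measure_Icc[OF assms(1) m cont] by simp
qed auto

text \<open>The preimage under \<open>F\<close> of an open interval is an open interval, and the
  Stieltjes measure of the latter is the difference of the values of \<open>F\<close> at its ends,
  which is the length of the former.\<close>

lemma distr_interval_measure_eq_lborel:
  assumes mono: "mono F" and cont: "continuous_on UNIV F" and surj: "surj F"
  shows "distr (interval_measure F) borel F = lborel"
proof (rule lborel_eqI[symmetric])
  have meas: "F \<in> measurable (interval_measure F) borel"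
    using borel_measurable_continuous_onI[OF cont] by simp
  fix l u :: real
  assume "\<And>b. b \<in> Basis \<Longrightarrow> l \<bullet> b \<le> u \<bullet> b"
  then have lu: "l \<le> u" by simp
  \<comment> \<open>\<open>F\<close> may have flat stretches. The last point with value
    \<open>l\<close> and the first with value \<open>u\<close> are the choices for which the
    preimage is exactly \<open>{A<..<B}\<close>; \<open>B < A\<close> can occur only for
    \<open>l = u\<close>.\<close>
  define A where "A = Sup {t. F t \<le> l}"
  define B where "B = Inf {t. u \<le> F t}"
  obtain s0 s1 where s: "F s0 = l" "F s1 = l + 1" using surj by (metis surjD)
  obtain t0 t1 where t: "F t0 = u" "F t1 = u - 1" using surj by (metis surjD)
  have bA: "bdd_above {t. F t \<le> l}"
    using s monoD[OF mono, of s1] by (intro bdd_aboveI[of _ s1]) (smt (verit) mem_Collect_eq)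
  have bB: "bdd_below {t. u \<le> F t}"
    using t monoD[OF mono, of _ t1] by (intro bdd_belowI[of _ t1]) (smt (verit) mem_Collect_eq)
  have "A \<in> {t. F t \<le> l}" unfolding A_def
    using s bA by (intro closed_contains_Sup closed_Collect_le continuous_intros cont) auto
  moreover have "s0 \<le> A" unfolding A_def using s by (intro cSup_upper bA) auto
  ultimately have FA: "F A = l" using monoD[OF mono, of s0 A] s by auto
  have "B \<in> {t. u \<le> F t}" unfolding B_def
    using t bB by (intro closed_contains_Inf closed_Collect_le continuous_intros cont) auto
  moreover have "B \<le> t0" unfolding B_def using t by (intro cInf_lower bB) auto
  ultimately have FB: "F B = u" using monoD[OF mono, of B t0] t by auto
  have "l < F x \<longleftrightarrow> A < x" for x
    using FA monoD[OF mono, of x A] cSup_upper[OF _ bA, of x]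
    by (fold A_def) (smt (verit) mem_Collect_eq)
  moreover have "F x < u \<longleftrightarrow> x < B" for x
    using FB monoD[OF mono, of B x] cInf_lower[OF _ bB, of x]
    by (fold B_def) (smt (verit) mem_Collect_eq)
  ultimately have eq: "F -` {l<..<u} = {A<..<B}" by auto
  show "emeasure (distr (interval_measure F) borel F) (box l u) = (\<Prod>b\<in>Basis. (u - l) \<bullet> b)"
  proof (cases "A \<le> B")
    case True
    then show ?thesis
      using meas lu by (simp add: emeasure_distr eq emeasure_interval_measure_Ioo mono cont FA FB)
  next
    case False
    then have "u = l" using monoD[OF mono, of B A] FA FB lu by simp
    then show ?thesis by simp
  qed
qed simp

lemma emeasure_measure_lincomb:
  assumes sets: "sets N = sets M" and A: "A \<in> sets M"
  shows "emeasure (measure_of (space M) (sets M) (\<lambda>A. emeasure M A + c * emeasure N A)) A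
    = emeasure M A + c * emeasure N A"
proof (rule emeasure_measure_of_sigma)
  show "sigma_algebra (space M) (sets M)" ..
  show "positive (sets M) (\<lambda>A. emeasure M A + c * emeasure N A)"
    by (simp add: positive_def)
  show "countably_additive (sets M) (\<lambda>A. emeasure M A + c * emeasure N A)"
  proof (rule countably_additiveI)
    fix B :: "nat \<Rightarrow> _" assume B: "range B \<subseteq> sets M" "disjoint_family B"
    have "(\<Sum>i. emeasure M (B i) + c * emeasure N (B i))
      = (\<Sum>i. emeasure M (B i)) + c * (\<Sum>i. emeasure N (B i))"
      by (simp add: suminf_add[symmetric])
    then show "(\<Sum>i. emeasure M (B i) + c * emeasure N (B i)) = emeasure M (\<Union> (range B)) + c * emeasure N (\<Union> (range B))"
      using B sets by (simp add: suminf_emeasure)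
  qed
qed (use A in auto)

text \<open>Both sides are measures that agree on half-open intervals, an intersection-stable
  generator of the Borel sets, and the line is exhausted by such intervals of finite
  measure.\<close>

lemma interval_measure_lincomb:
  assumes F: "mono F" "continuous_on UNIV F" and G: "mono G" "continuous_on UNIV G"
    and c: "c \<ge> 0" and A: "A \<in> sets borel"
  shows "emeasure (interval_measure (\<lambda>t. F t + c * G t)) A
    = emeasure (interval_measure F) A + ennreal c * emeasure (interval_measure G) A"
proof -
  let ?H = "\<lambda>t. F t + c * G t"
  let ?N = "measure_of (space (interval_measure F)) (sets (interval_measure F))
    (\<lambda>A. emeasure (interval_measure F) A + ennreal c * emeasure (interval_measure G) A)"
  have N: "emeasure ?N B = emeasure (interval_measure F) B + ennreal c * emeasure (interval_measure G) B"
    if "B \<in> sets borel" for B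
    using that by (intro emeasure_measure_lincomb) auto
  have sN: "sets ?N = sets borel"
    using sets.sets_measure_of_eq[of "interval_measure F"] by simp
  have rc: "continuous (at_right a) f" if "continuous_on UNIV f" for a and f :: "real \<Rightarrow> real"
    using that by (simp add: continuous_on_eq_continuous_within continuous_at_imp_continuous_at_within)
  have H: "mono ?H" "continuous_on UNIV ?H"
    using F G c by (auto simp: mono_def intro!: add_mono mult_left_mono continuous_intros)
  have Ioc: "emeasure (interval_measure ?H) {a<..b} = emeasure ?N {a<..b}" if "a \<le> b" for a b
  proof -
    have "emeasure (interval_measure ?H) {a<..b} = ?H b - ?H a"
      using that H by (intro emeasure_interval_measure_Ioc rc) (auto dest: monoD)
    moreover have "emeasure (interval_measure F) {a<..b} = F b - F a"
      using that F by (intro emeasure_interval_measure_Ioc rc) (auto dest: monoD)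
    moreover have "emeasure (interval_measure G) {a<..b} = G b - G a"
      using that G by (intro emeasure_interval_measure_Ioc rc) (auto dest: monoD)
    moreover have "ennreal (?H b - ?H a) = ennreal (F b - F a) + ennreal c * ennreal (G b - G a)"
    proof -
      have "?H b - ?H a = (F b - F a) + c * (G b - G a)" by (simp add: algebra_simps)
      then show ?thesis
        using c monoD[OF F(1) that] monoD[OF G(1) that]
        by (simp only: ennreal_plus ennreal_mult diff_ge_0_iff_ge mult_nonneg_nonneg)
    qed
    ultimately show ?thesis using N[of "{a<..b}"] by simp
  qed
  have "interval_measure ?H = ?N"
  proof (rule measure_eqI_generator_eq[where A = "\<lambda>n::nat. {- real n<..real n}"])
    let ?E = "range (\<lambda>(a, b). {a<..b::real})"
    show "Int_stable ?E"
    proof (rule Int_stableI_image)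
      show "\<exists>k\<in>UNIV. (case i of (a, b) \<Rightarrow> {a<..b}) \<inter> (case j of (a, b) \<Rightarrow> {a<..b})
          = (case k of (a, b) \<Rightarrow> {a<..b})" for i j :: "real \<times> real"
        by (cases i, cases j) (auto simp: Int_greaterThanAtMost)
    qed
    show "emeasure (interval_measure ?H) X = emeasure ?N X" if XE: "X \<in> ?E" for X
    proof -
      obtain a b where X: "X = {a<..b}" using XE by auto
      show ?thesis by (cases "a \<le> b") (use Ioc in \<open>auto simp: X\<close>)
    qed
    show "sets (interval_measure ?H) = sigma_sets UNIV ?E" "sets ?N = sigma_sets UNIV ?E"
      using sN by (auto simp: borel_sigma_sets_Ioc)
    show "(\<Union>n::nat. {- real n<..real n}) = UNIV"
    proof safe
      fix x :: real
      obtain n :: nat where "\<bar>x\<bar> < real n" using reals_Archimedean2 by blast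
      then show "x \<in> (\<Union>n::nat. {- real n<..real n})" by (auto intro!: exI[of _ n])
    qed auto
    show "emeasure (interval_measure ?H) {- real n<..real n} \<noteq> \<infinity>" for n
      using H by (subst emeasure_interval_measure_Ioc) (auto intro: rc dest: monoD)
  qed auto
  then show ?thesis using N[OF A] by simp
qed

subsection \<open>The Hessian measures\<close>

text \<open>On a bounded set all values are finite, and a polynomial of degree one is determined by
  its values at \<open>s = 1\<close> and \<open>s = 2\<close>. Exhaustion by balls extends the
  equality to all Borel sets.\<close>

lemma is_hessian_measures_unique:
  assumes T: "is_hessian_measures v T0 T1" and S: "is_hessian_measures v S0 S1"
    and fin: "\<And>\<eta>. \<eta> \<in> sets borel \<Longrightarrow> bounded \<eta> \<Longrightarrow> emeasure S0 \<eta> < \<infinity> \<and> emeasure S1 \<eta> < \<infinity>"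
  shows "T0 = S0"
proof (rule measure_eqI)
  show sets: "sets T0 = sets S0" using T S by (simp add: is_hessian_measures_def)
  have bdd: "emeasure T0 \<eta> = emeasure S0 \<eta>" if \<eta>: "\<eta> \<in> sets borel" "bounded \<eta>" for \<eta>
  proof -
    have eq: "emeasure T1 \<eta> + ennreal s * emeasure T0 \<eta> = emeasure S1 \<eta> + ennreal s * emeasure S0 \<eta>"
      if "s > 0" for s
      using T S \<eta>(1) that unfolding is_hessian_measures_def by metis
    have eq1: "emeasure T1 \<eta> + emeasure T0 \<eta> = emeasure S1 \<eta> + emeasure S0 \<eta>"
      using eq[of 1] by simp
    have eq2: "emeasure T1 \<eta> + 2 * emeasure T0 \<eta> = emeasure S1 \<eta> + 2 * emeasure S0 \<eta>"
      using eq[of 2] by simp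
    have S_fin: "emeasure S0 \<eta> < \<infinity>" "emeasure S1 \<eta> < \<infinity>" using fin \<eta> by auto
    then have "emeasure T1 \<eta> + emeasure T0 \<eta> < \<infinity>" using eq1 by simp
    then have T_fin: "emeasure T0 \<eta> < \<infinity>" "emeasure T1 \<eta> < \<infinity>" by auto
    \<comment> \<open>The difference of the two identities, written additively so that only a finite
      term has to be cancelled.\<close>
    have "(emeasure T1 \<eta> + emeasure T0 \<eta>) + emeasure T0 \<eta>
        = (emeasure T1 \<eta> + emeasure T0 \<eta>) + emeasure S0 \<eta>"
      using eq1 eq2 by (simp add: add.assoc mult_2) (simp add: add.assoc[symmetric])
    then show ?thesis using T_fin by (auto simp: ennreal_add_left_cancel)
  qed
  fix \<eta> assume "\<eta> \<in> sets T0"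
  then have \<eta>: "\<eta> \<in> sets borel" using T by (simp add: is_hessian_measures_def)
  define W where "W n = \<eta> \<inter> cball 0 (real n)" for n
  have W: "W n \<in> sets borel" "bounded (W n)" for n
    using \<eta> by (auto simp: W_def intro: bounded_subset[OF bounded_cball])
  have "incseq W" by (auto simp: W_def incseq_def)
  moreover have UW: "(\<Union>n. W n) = \<eta>"
    using real_arch_simple by (auto simp: W_def)
  ultimately have "(\<lambda>n. emeasure T0 (W n)) \<longlonglongrightarrow> emeasure T0 \<eta>" "(\<lambda>n. emeasure S0 (W n)) \<longlonglongrightarrow> emeasure S0 \<eta>"
    using Lim_emeasure_incseq[of W T0] Lim_emeasure_incseq[of W S0] W(1) T S
    by (auto simp: is_hessian_measures_def)
  then show "emeasure T0 \<eta> = emeasure S0 \<eta>"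
    using bdd[OF W] LIMSEQ_unique by simp
qed

definition prox_graph_measure :: "(real \<Rightarrow> real) \<Rightarrow> (real \<Rightarrow> real) \<Rightarrow> (real \<times> real) measure" where
  "prox_graph_measure v F = distr (interval_measure F) borel (\<lambda>t. (prox v t, t - prox v t))"

section \<open>Lebesgue measure of \<open>P_set\<close> in Minty's parametrization\<close>

context
  fixes v :: "real \<Rightarrow> real"
  assumes v: "v \<in> Conv"
begin

lemma prox_measurable: "prox v \<in> borel_measurable borel"
  using prox_continuous[OF v] by (rule borel_measurable_continuous_onI)

lemma prox_compl_continuous: "continuous_on UNIV (\<lambda>t. t - prox v t)"
  by (intro continuous_intros prox_continuous v)

lemma prox_graph_measurable:
  "(\<lambda>t. (prox v t, t - prox v t)) \<in> measurable (interval_measure F) borel"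
  using prox_measurable by (simp flip: borel_prod)

lemma emeasure_prox_graph_measure:
  "\<eta> \<in> sets borel \<Longrightarrow> emeasure (prox_graph_measure v F) \<eta>
    = emeasure (interval_measure F) {t. (prox v t, t - prox v t) \<in> \<eta>}"
  unfolding prox_graph_measure_def
  by (subst emeasure_distr[OF prox_graph_measurable]) (auto simp: vimage_def)

text \<open>In the parameter \<open>t\<close>, \<open>P_set\<close> is the image of
  \<open>?B\<close> under \<open>h\<close>, which is \<open>x + s * y\<close> along the graph. As
  \<open>h\<close> is an increasing bijection that pushes its Stieltjes measure to Lebesgue measure,
  the measure of this image is that of \<open>?B\<close> under
  \<open>dh = dx + s dy\<close>.\<close>

lemma emeasure_P_set:
  assumes \<eta>: "\<eta> \<in> sets borel" and s: "s > 0"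
  shows "emeasure lebesgue (P_set s v \<eta>) = emeasure (interval_measure (prox v)) {t. (prox v t, t - prox v t) \<in> \<eta>}
    + ennreal s * emeasure (interval_measure (\<lambda>t. t - prox v t)) {t. (prox v t, t - prox v t) \<in> \<eta>}"
proof -
  define h where "h t = prox v t + s * (t - prox v t)" for t
  let ?B = "{t. (prox v t, t - prox v t) \<in> \<eta>}"
  have B: "?B \<in> sets borel"
    using measurable_sets[OF prox_graph_measurable[of id] \<eta>] by (simp add: vimage_def)
  \<comment> \<open>A lower bound for the growth rate of \<open>h\<close>, because
    \<open>dt = dx + dy\<close>; its positivity makes \<open>h\<close> both injective and
    surjective.\<close>
  define m where "m = min 1 s"
  have m: "m > 0" using s by (simp add: m_def)
  have growth: "h t' - h t \<ge> m * (t' - t)" if "t \<le> t'" for t t'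
  proof -
    have p: "prox v t' - prox v t \<ge> 0" "(t' - prox v t') - (t - prox v t) \<ge> 0"
      using monoD[OF prox_mono[OF v] that] monoD[OF prox_compl_mono[OF v] that] by auto
    have "m * (prox v t' - prox v t) \<le> 1 * (prox v t' - prox v t)"
      using p by (intro mult_right_mono) (auto simp: m_def)
    moreover have "m * ((t' - prox v t') - (t - prox v t)) \<le> s * ((t' - prox v t') - (t - prox v t))"
      using p by (intro mult_right_mono) (auto simp: m_def)
    ultimately show ?thesis by (simp add: h_def algebra_simps)
  qed
  have h_strict: "h t < h t'" if "t < t'" for t t'
    using growth[of t t'] m that by (smt (verit) mult_pos_pos)
  have "strict_mono h" using h_strict by (rule strict_monoI)
  then have inj: "inj h" and mono: "mono h"
    by (auto intro: strict_mono_imp_inj_on strict_mono_mono)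
  have cont: "continuous_on A h" for A
    unfolding h_def by (intro continuous_intros prox_continuous v)
  have surj: "surj h"
  proof -
    have "\<exists>t. h t = c" for c
    proof -
      define r where "r = \<bar>c - h 0\<bar> / m"
      have r: "r \<ge> 0" "m * r = \<bar>c - h 0\<bar>" using m by (auto simp: r_def)
      have "h (- r) \<le> c" "c \<le> h r"
        using growth[of "-r" 0] growth[of 0 r] r by auto
      then show ?thesis using IVT'[of h "- r" c r] r cont by auto
    qed
    then show ?thesis by (metis surjI)
  qed
  define g where "g = inv h"
  have g: "g (h t) = t" for t by (simp add: g_def inj)
  have hg: "h (g a) = a" for a using surj by (simp add: g_def surj_f_inv_f)
  have "mono g"
  proof (rule monoI)
    fix a b :: real assume "a \<le> b"
    then show "g a \<le> g b" using h_strict[of "g b" "g a"] hg[of a] hg[of b] by linarith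
  qed
  have "range (\<lambda>t. (prox v t, t - prox v t)) \<inter> \<eta> = (\<lambda>t. (prox v t, t - prox v t)) ` ?B"
    by blast
  then have P: "P_set s v \<eta> = h ` ?B"
    unfolding P_set_def subdiff_graph_eq_prox[OF v] by (simp add: image_image h_def)
  have hB: "h ` ?B = g -` ?B \<inter> UNIV"
  proof safe
    fix a assume "(prox v (g a), g a - prox v (g a)) \<in> \<eta>"
    then show "a \<in> h ` ?B" by (intro image_eqI[of _ _ "g a"]) (simp_all add: hg)
  qed (simp_all add: g)
  have meas: "h ` ?B \<in> sets borel"
    unfolding hB using measurable_sets[OF borel_measurable_mono[OF \<open>mono g\<close>] B] by simp
  have "emeasure lebesgue (P_set s v \<eta>) = emeasure lborel (h ` ?B)"
    unfolding P using meas by (simp add: emeasure_completion)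
  also have "\<dots> = emeasure (distr (interval_measure h) borel h) (h ` ?B)"
    using distr_interval_measure_eq_lborel[OF mono cont surj] by simp
  also have "\<dots> = emeasure (interval_measure h) ?B"
    using borel_measurable_continuous_onI[OF cont] meas
    by (simp add: emeasure_distr inj_vimage_image_eq[OF inj])
  also have "\<dots> = emeasure (interval_measure (prox v)) ?B + ennreal s * emeasure (interval_measure (\<lambda>t. t - prox v t)) ?B"
    unfolding h_def using s B
    by (intro interval_measure_lincomb prox_mono prox_compl_mono prox_continuous prox_compl_continuous v) auto
  finally show ?thesis .
qed

text \<open>Since \<open>t\<close> is the sum of the two coordinates of its graph point, a bounded
  set of graph points has a bounded set of parameters.\<close>

lemma emeasure_prox_graph_measure_bounded:
  assumes "\<eta> \<in> sets borel" "bounded \<eta>" and F: "mono F" "continuous_on UNIV F"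
  shows "emeasure (prox_graph_measure v F) \<eta> < \<infinity>"
proof -
  obtain R where R: "\<And>z. z \<in> \<eta> \<Longrightarrow> norm z \<le> R" using assms(2) by (auto simp: bounded_iff)
  have "{t. (prox v t, t - prox v t) \<in> \<eta>} \<subseteq> {- (2 * \<bar>R\<bar>)..2 * \<bar>R\<bar>}"
  proof clarify
    fix t assume "(prox v t, t - prox v t) \<in> \<eta>"
    then have "norm (prox v t, t - prox v t) \<le> R" using R by blast
    then have "\<bar>prox v t\<bar> \<le> R" "\<bar>t - prox v t\<bar> \<le> R"
      using norm_fst_le[of "prox v t" "t - prox v t"] norm_snd_le[of "t - prox v t" "prox v t"] by auto
    then show "t \<in> {- (2 * \<bar>R\<bar>)..2 * \<bar>R\<bar>}" by auto
  qed
  then have "emeasure (prox_graph_measure v F) \<eta> \<le> emeasure (interval_measure F) {- (2 * \<bar>R\<bar>)..2 * \<bar>R\<bar>}"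
    using assms(1) by (simp add: emeasure_prox_graph_measure emeasure_mono)
  also have "\<dots> < \<infinity>"
    using F by (subst emeasure_interval_measure_Icc) (auto dest: monoD)
  finally show ?thesis .
qed

lemma hessian_measure0_eq_prox:
  "hessian_measure0 v = prox_graph_measure v (\<lambda>t. t - prox v t)"
  unfolding hessian_measure0_def
proof (rule the_equality)
  let ?S0 = "prox_graph_measure v (\<lambda>t. t - prox v t)" and ?S1 = "prox_graph_measure v (prox v)"
  have S: "is_hessian_measures v ?S0 ?S1"
    unfolding is_hessian_measures_def
    by (simp add: emeasure_P_set emeasure_prox_graph_measure) (simp add: prox_graph_measure_def)
  then show "\<exists>T1. is_hessian_measures v ?S0 T1" by blast
  fix T0 assume "\<exists>T1. is_hessian_measures v T0 T1"
  then show "T0 = ?S0"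
    using is_hessian_measures_unique[OF _ S] emeasure_prox_graph_measure_bounded
      prox_mono[OF v] prox_compl_mono[OF v] prox_continuous[OF v] prox_compl_continuous
    by blast
qed

end

subsection \<open>Integration against the Hessian measure\<close>

lemma nn_integral_interval_measure_add:
  assumes F: "mono F" "continuous_on UNIV F" and G: "mono G" "continuous_on UNIV G"
    and f: "f \<in> borel_measurable borel"
  shows "(\<integral>\<^sup>+t. f t \<partial>interval_measure (\<lambda>t. F t + G t))
    = (\<integral>\<^sup>+t. f t \<partial>interval_measure F) + (\<integral>\<^sup>+t. f t \<partial>interval_measure G)"
  using f
proof (induction rule: borel_measurable_induct)
  case (cong f g)
  then have "f = g" by auto
  with cong show ?case by simp
next
  case (set A)
  then show ?case using interval_measure_lincomb[OF F G, of 1 A] by simp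
next
  case (mult u c)
  then show ?case by (simp add: nn_integral_cmult distrib_left)
next
  case (add u w)
  then show ?case by (simp add: nn_integral_add ac_simps)
next
  case (seq U)
  have SUP: "(\<integral>\<^sup>+t. (SUP i. U i) t \<partial>interval_measure H) = (SUP i. \<integral>\<^sup>+t. U i t \<partial>interval_measure H)" for H
    using nn_integral_monotone_convergence_SUP[OF seq(3), of "interval_measure H"] seq(1)
    by (simp add: SUP_apply image_image)
  have inc: "incseq (\<lambda>i. \<integral>\<^sup>+t. U i t \<partial>interval_measure H)" for H
    using seq(3) by (auto simp: incseq_def le_fun_def intro!: nn_integral_mono)
  show ?case
    unfolding SUP seq.IH by (intro ennreal_SUP_add inc)
qed

text \<open>Integrability for the sum gives integrability for each summand, so positive and negative
  parts can be added separately and subtracted as finite numbers.\<close>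

lemma integral_interval_measure_add:
  fixes f :: "real \<Rightarrow> real"
  assumes F: "mono F" "continuous_on UNIV F" and G: "mono G" "continuous_on UNIV G"
    and f: "f \<in> borel_measurable borel" and int: "integrable (interval_measure (\<lambda>t. F t + G t)) f"
  shows "(\<integral>t. f t \<partial>interval_measure (\<lambda>t. F t + G t))
    = (\<integral>t. f t \<partial>interval_measure F) + (\<integral>t. f t \<partial>interval_measure G)"
proof -
  note add = nn_integral_interval_measure_add[OF F G]
  have "(\<integral>\<^sup>+t. norm (f t) \<partial>interval_measure F) + (\<integral>\<^sup>+t. norm (f t) \<partial>interval_measure G) < \<infinity>"
    using int f by (subst add[symmetric]) (auto simp: integrable_iff_bounded)
  then have iF: "integrable (interval_measure F) f" and iG: "integrable (interval_measure G) f"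
    using f by (auto simp: integrable_iff_bounded)
  have fin: "(\<integral>\<^sup>+t. ennreal (f t) \<partial>interval_measure F) < \<infinity>" "(\<integral>\<^sup>+t. ennreal (- f t) \<partial>interval_measure F) < \<infinity>"
    "(\<integral>\<^sup>+t. ennreal (f t) \<partial>interval_measure G) < \<infinity>" "(\<integral>\<^sup>+t. ennreal (- f t) \<partial>interval_measure G) < \<infinity>"
    using iF iG unfolding real_integrable_def by (auto simp: less_top)
  have "(\<integral>\<^sup>+t. ennreal (f t) \<partial>interval_measure (\<lambda>t. F t + G t))
      = (\<integral>\<^sup>+t. ennreal (f t) \<partial>interval_measure F) + (\<integral>\<^sup>+t. ennreal (f t) \<partial>interval_measure G)"
    "(\<integral>\<^sup>+t. ennreal (- f t) \<partial>interval_measure (\<lambda>t. F t + G t))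
      = (\<integral>\<^sup>+t. ennreal (- f t) \<partial>interval_measure F) + (\<integral>\<^sup>+t. ennreal (- f t) \<partial>interval_measure G)"
    using f by (auto intro!: add)
  then show ?thesis
    using fin by (simp add: real_lebesgue_integral_def int iF iG enn2real_plus)
qed

lemma Cc_bounds:
  assumes "\<zeta> \<in> Cc"
  obtains R M where "R > 0" "\<And>x. \<bar>x\<bar> \<ge> R \<Longrightarrow> \<zeta> x = 0" "\<And>x. \<bar>\<zeta> x\<bar> \<le> M"
proof -
  let ?S = "closure {x. \<zeta> x \<noteq> 0}"
  have cont: "continuous_on UNIV \<zeta>" and cpt: "compact ?S" using assms by (auto simp: Cc_def)
  obtain R where R: "R > 0" "\<And>x. x \<in> ?S \<Longrightarrow> norm x \<le> R"
    using compact_imp_bounded[OF cpt] bounded_pos by metis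
  have "compact (\<zeta> ` ?S)"
    using cont cpt by (intro compact_continuous_image) (auto intro: continuous_on_subset)
  then obtain M where M: "M > 0" "\<And>x. x \<in> ?S \<Longrightarrow> \<bar>\<zeta> x\<bar> \<le> M"
    using compact_imp_bounded bounded_pos by (metis (no_types, lifting) imageI real_norm_def)
  show ?thesis
  proof (rule that[of "R + 1" M])
    show "\<zeta> x = 0" if "\<bar>x\<bar> \<ge> R + 1" for x
    proof (rule ccontr)
      assume "\<zeta> x \<noteq> 0"
      then have "x \<in> ?S" using closure_subset[of "{x. \<zeta> x \<noteq> 0}"] by blast
      then have "norm x \<le> R" by (rule R(2))
      then show False using that by simp
    qed
    show "\<bar>\<zeta> x\<bar> \<le> M" for x
    proof (cases "\<zeta> x = 0")
      case False
      then have "x \<in> ?S" using closure_subset[of "{x. \<zeta> x \<noteq> 0}"] by blast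
      then show ?thesis by (rule M(2))
    qed (use M in simp)
  qed (use R in auto)
qed

lemma Cc_measurable: "\<zeta> \<in> Cc \<Longrightarrow> \<zeta> \<in> borel_measurable borel"
  by (auto simp: Cc_def intro: borel_measurable_continuous_onI)

lemma Cc_prox_measurable:
  "\<zeta> \<in> Cc \<Longrightarrow> v \<in> Conv \<Longrightarrow> (\<lambda>t. \<zeta> (prox v t)) \<in> borel_measurable borel"
  using measurable_compose[OF prox_measurable Cc_measurable] .

text \<open>By monotonicity \<open>prox v\<close> has left the open interval from \<open>-R\<close>
  to \<open>R\<close> once \<open>t\<close> is outside \<open>{\<alpha>..\<beta>}\<close>. This
  bound serves both integrability and dominated convergence.\<close>

lemma Cc_prox_bound:
  assumes v: "v \<in> Conv" and R: "\<And>x. \<bar>x\<bar> \<ge> R \<Longrightarrow> \<zeta> x = 0" and M: "\<And>x. \<bar>\<zeta> x\<bar> \<le> M"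
    and ends: "prox v \<alpha> \<le> - R" "prox v \<beta> \<ge> R"
  shows "norm (\<zeta> (prox v t)) \<le> M * indicator {\<alpha>..\<beta>} t"
proof (cases "t \<in> {\<alpha>..\<beta>}")
  case False
  then have "\<bar>prox v t\<bar> \<ge> R"
    using monoD[OF prox_mono[OF v], of t \<alpha>] monoD[OF prox_mono[OF v], of \<beta> t] ends by force
  then show ?thesis using R False by simp
qed (use M in simp)

lemma integrable_Cc_prox:
  assumes "\<zeta> \<in> Cc" "v \<in> Conv"
  shows "integrable lborel (\<lambda>t. \<zeta> (prox v t))"
proof -
  obtain R M where RM: "R > 0" "\<And>x. \<bar>x\<bar> \<ge> R \<Longrightarrow> \<zeta> x = 0" "\<And>x. \<bar>\<zeta> x\<bar> \<le> M"
    using Cc_bounds[OF assms(1)] by blast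
  obtain \<alpha> \<beta> where "prox v \<alpha> = - R" "prox v \<beta> = R"
    using prox_surj[OF assms(2)] by (metis surjD)
  then have bound: "norm (\<zeta> (prox v t)) \<le> M * indicator {\<alpha>..\<beta>} t" for t
    by (intro Cc_prox_bound[OF assms(2), where R = R] RM) auto
  show ?thesis
  proof (rule Bochner_Integration.integrable_bound)
    show "integrable lborel (\<lambda>t. M * indicator {\<alpha>..\<beta>} t :: real)"
      by (intro integrable_mult_right integrable_real_indicator) (simp_all add: emeasure_lborel_Icc_eq)
    show "(\<lambda>t. \<zeta> (prox v t)) \<in> borel_measurable lborel"
      using Cc_prox_measurable[OF assms] by simp
    show "AE t in lborel. norm (\<zeta> (prox v t)) \<le> norm (M * indicator {\<alpha>..\<beta>} t :: real)"
      by (intro AE_I2 order_trans[OF bound]) (simp only: real_norm_def abs_ge_self)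
  qed
qed

lemma integral_hessian_measure0:
  assumes \<zeta>: "\<zeta> \<in> Cc" and v: "v \<in> Conv"
  shows "(\<integral>(x, y). \<zeta> x \<partial>hessian_measure0 v) = (\<integral>t. \<zeta> (prox v t) \<partial>lborel) - (\<integral>x. \<zeta> x \<partial>lborel)"
proof -
  \<comment> \<open>The splitting \<open>dt = dx + dy\<close>: the first part is pushed to Lebesgue
    measure by \<open>prox v\<close>, the second is the integral sought.\<close>
  have sum: "interval_measure (\<lambda>t. prox v t + (t - prox v t)) = lborel"
    by (simp add: lborel_eq_real)
  have "(\<integral>t. \<zeta> (prox v t) \<partial>lborel) = (\<integral>t. \<zeta> (prox v t) \<partial>interval_measure (prox v))
      + (\<integral>t. \<zeta> (prox v t) \<partial>interval_measure (\<lambda>t. t - prox v t))"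
    using integral_interval_measure_add[OF prox_mono[OF v] prox_continuous[OF v]
        prox_compl_mono[OF v] prox_compl_continuous[OF v] Cc_prox_measurable[OF \<zeta> v]]
      integrable_Cc_prox[OF \<zeta> v]
    unfolding sum by blast
  also have "(\<integral>t. \<zeta> (prox v t) \<partial>interval_measure (prox v))
      = (\<integral>x. \<zeta> x \<partial>distr (interval_measure (prox v)) borel (prox v))"
    using prox_measurable[OF v] Cc_measurable[OF \<zeta>] by (subst integral_distr) auto
  also have "\<dots> = (\<integral>x. \<zeta> x \<partial>lborel)"
    using distr_interval_measure_eq_lborel[OF prox_mono[OF v] prox_continuous[OF v] prox_surj[OF v]]
    by (rule arg_cong)
  also have "(\<integral>t. \<zeta> (prox v t) \<partial>interval_measure (\<lambda>t. t - prox v t)) = (\<integral>(x, y). \<zeta> x \<partial>hessian_measure0 v)"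
  proof -
    have "(\<lambda>(x, y). \<zeta> x) \<in> borel_measurable (borel :: (real \<times> real) measure)"
      using Cc_measurable[OF \<zeta>] by (simp flip: borel_prod)
    then show ?thesis
      unfolding hessian_measure0_eq_prox[OF v] prox_graph_measure_def
      by (subst integral_distr[OF prox_graph_measurable[OF v]]) auto
  qed
  finally show ?thesis by simp
qed

subsection \<open>The integral functionals are valuations\<close>

lemma subdifferential_add_linear:
  "y \<in> subdifferential v x \<Longrightarrow> y + c \<in> subdifferential (\<lambda>x. v x + (c * x + \<alpha>)) x"
  by (auto simp: subdifferential_def algebra_simps)

lemma Conv_affine: "(\<lambda>x. c * x + \<alpha>) \<in> Conv"
  unfolding Conv_def mem_Collect_eq by (rule convex_onI) (auto simp: algebra_simps)

lemma Conv_add: "u \<in> Conv \<Longrightarrow> v \<in> Conv \<Longrightarrow> (\<lambda>x. u x + v x) \<in> Conv"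
  by (simp add: Conv_def convex_on_add)

text \<open>Subgradients grow by \<open>c\<close>, so the graph point with parameter
  \<open>t - c\<close> receives parameter \<open>t\<close>.\<close>

lemma prox_add_affine:
  assumes "v \<in> Conv"
  shows "prox (\<lambda>x. v x + (c * x + \<alpha>)) t = prox v (t - c)"
  using subdifferential_add_linear[OF prox_subgradient[OF assms, of "t - c"], of c \<alpha>]
  by (intro prox_eqI) simp

text \<open>When \<open>u\<close> has the smaller minimum of the penalized problem at
  \<open>t\<close>, its minimizer also solves the problem for the minimum. For the maximum it
  suffices that \<open>u \<le> v\<close> at \<open>prox v t\<close>, since then the maximum has
  there the value of \<open>v\<close>, which it dominates everywhere.\<close>

lemma prox_min_max:
  assumes u: "u \<in> Conv" and v: "v \<in> Conv"
    and max: "(\<lambda>x. max (u x) (v x)) \<in> Conv" and min: "(\<lambda>x. min (u x) (v x)) \<in> Conv"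
    and le: "u (prox u t) + (prox u t - t)\<^sup>2 / 2 \<le> v (prox v t) + (prox v t - t)\<^sup>2 / 2"
  shows "prox (\<lambda>x. min (u x) (v x)) t = prox u t" and "prox (\<lambda>x. max (u x) (v x)) t = prox v t"
proof -
  define p r where "p = prox u t" and "r = prox v t"
  have *: "w q + (q - t)\<^sup>2 / 2 + (z - q)\<^sup>2 / 2 \<le> w z + (z - t)\<^sup>2 / 2" if "w q + (z - q) * (t - q) \<le> w z"
    for w q z using that by (simp add: field_simps power2_eq_square)
  have "u p + (z - p) * (t - p) \<le> u z" "v r + (z - r) * (t - r) \<le> v z" for z
    using prox_subgradient[OF u, of t] prox_subgradient[OF v, of t]
    by (auto simp: subdifferential_def p_def r_def)
  then have U': "u p + (p - t)\<^sup>2 / 2 + (z - p)\<^sup>2 / 2 \<le> u z + (z - t)\<^sup>2 / 2"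
    and V': "v r + (r - t)\<^sup>2 / 2 + (z - r)\<^sup>2 / 2 \<le> v z + (z - t)\<^sup>2 / 2" for z
    by (auto intro: *)
  have U: "u p + (p - t)\<^sup>2 / 2 \<le> u z + (z - t)\<^sup>2 / 2"
    and V: "v r + (r - t)\<^sup>2 / 2 \<le> v z + (z - t)\<^sup>2 / 2" for z
    using U'[of z] V'[of z] zero_le_power2[of "z - p"] zero_le_power2[of "z - r"] by linarith+
  have le': "u p + (p - t)\<^sup>2 / 2 \<le> v r + (r - t)\<^sup>2 / 2" using le by (simp add: p_def r_def)
  have pm: "prox (\<lambda>x. min (u x) (v x)) t = p"
  proof (intro prox_eqI subdifferential_of_prox_min min)
    show "min (u p) (v p) + (p - t)\<^sup>2 / 2 \<le> min (u z) (v z) + (z - t)\<^sup>2 / 2" for z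
      using U[of z] V[of z] le' by linarith
  qed
  then show "prox (\<lambda>x. min (u x) (v x)) t = prox u t" by (simp add: p_def)
  \<comment> \<open>Convexity of the minimum enters here. Otherwise the minimum equals
    \<open>v\<close> near \<open>r\<close>, so \<open>r\<close> would be its proximal point
    \<open>p\<close>, and \<open>v r < u r\<close> would contradict the order of the two minimal
    values.\<close>
  have "u r \<le> v r"
  proof (rule ccontr)
    assume less: "\<not> u r \<le> v r"
    have "t - r \<in> subdifferential (\<lambda>x. min (u x) (v x)) r"
    proof (rule local_subgradient_imp_subdifferential[OF min])
      show "open {x. v x < u x}"
        using Conv_continuous u v by (intro open_Collect_less) auto
      show "r \<in> {x. v x < u x}" using less by simp
      show "min (u z) (v z) \<ge> min (u r) (v r) + (z - r) * (t - r)" if "z \<in> {x. v x < u x}" for z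
        using that less prox_subgradient[OF v, of t] by (auto simp: subdifferential_def r_def)
    qed
    then have "r = p" using prox_eqI pm by metis
    then show False using less le' by simp
  qed
  moreover have "t - r \<in> subdifferential (\<lambda>x. max (u x) (v x)) r"
  proof (intro subdifferential_of_prox_min max)
    show "max (u r) (v r) + (r - t)\<^sup>2 / 2 \<le> max (u z) (v z) + (z - t)\<^sup>2 / 2" for z
      using V[of z] \<open>u r \<le> v r\<close> by linarith
  qed
  ultimately show "prox (\<lambda>x. max (u x) (v x)) t = prox v t"
    unfolding r_def by (intro prox_eqI)
qed

lemma prox_valuation:
  fixes \<zeta> :: "real \<Rightarrow> real"
  assumes "u \<in> Conv" "v \<in> Conv" "(\<lambda>x. max (u x) (v x)) \<in> Conv" "(\<lambda>x. min (u x) (v x)) \<in> Conv"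
  shows "\<zeta> (prox (\<lambda>x. max (u x) (v x)) t) + \<zeta> (prox (\<lambda>x. min (u x) (v x)) t)
    = \<zeta> (prox u t) + \<zeta> (prox v t)"
proof (cases "u (prox u t) + (prox u t - t)\<^sup>2 / 2 \<le> v (prox v t) + (prox v t - t)\<^sup>2 / 2")
  case True
  then show ?thesis using prox_min_max[of u v t] assms by simp
next
  case False
  then show ?thesis
    using prox_min_max[of v u t] assms by (simp add: max.commute min.commute)
qed

section \<open>Convergence of proximal maps under epi-convergence\<close>

text \<open>Every subgradient \<open>s - a\<close> at \<open>a\<close> compares with
  \<open>t - a\<close> in the direction that helps on the side of \<open>z\<close>. Used in
  contrapositive form: if the inequality fails, \<open>prox v t\<close> lies strictly on the same
  side of \<open>a\<close> as \<open>z\<close>.\<close>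

lemma prox_between:
  assumes v: "v \<in> Conv" and le: "(prox v t - a) * (z - a) \<le> 0"
  shows "v z \<ge> v a + (z - a) * (t - a)"
proof -
  obtain s where s: "prox v s = a" using prox_surj[OF v] by (metis surjD)
  have sub: "v z \<ge> v a + (z - a) * (s - a)"
    using prox_subgradient[OF v, of s] s by (auto simp: subdifferential_def)
  consider "prox v t = a" | "prox v t < a" | "prox v t > a" by linarith
  then show ?thesis
  proof cases
    case 1
    then show ?thesis using prox_subgradient[OF v, of t] by (auto simp: subdifferential_def)
  next
    case 2
    then have "\<not> s \<le> t" "z \<ge> a"
      using monoD[OF prox_mono[OF v], of s t] s le by (auto simp: mult_le_0_iff)
    then have "(z - a) * (t - a) \<le> (z - a) * (s - a)" by (intro mult_left_mono) auto
    then show ?thesis using sub by linarith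
  next
    case 3
    then have "\<not> t \<le> s" "z \<le> a"
      using monoD[OF prox_mono[OF v], of t s] s le by (auto simp: mult_le_0_iff)
    then have "(z - a) * (t - a) \<le> (z - a) * (s - a)" by (intro mult_left_mono_neg) auto
    then show ?thesis using sub by linarith
  qed
qed

text \<open>For each \<open>a \<noteq> p\<close> the proximal points are eventually on the same side
  of \<open>a\<close> as \<open>p\<close>. The lower limit along the constant sequence
  \<open>a\<close> and a recovery sequence at \<open>p\<close> make the inequality of
  \<open>prox_between\<close> fail.\<close>

lemma epi_converges_imp_prox_tendsto:
  assumes v: "v \<in> Conv" and vs: "\<And>k. vs k \<in> Conv" and epi: "epi_converges vs v"
  shows "(\<lambda>k. prox (vs k) t) \<longlonglongrightarrow> prox v t"
proof -
  define p where "p = prox v t"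
  obtain q where q: "q \<longlonglongrightarrow> p" "(\<lambda>k. vs k (q k)) \<longlonglongrightarrow> v p"
    using epi unfolding epi_converges_def by blast
  have side: "\<forall>\<^sub>F k in sequentially. (prox (vs k) t - a) * (p - a) > 0" if "a \<noteq> p" for a
  proof -
    \<comment> \<open>Moving the base point of the subgradient inequality from \<open>p\<close> to
      \<open>a\<close> leaves a slack of \<open>2 * e\<close>; one \<open>e\<close> is spent on each
      of the two limits.\<close>
    define e where "e = (a - p)\<^sup>2 / 2"
    have e: "e > 0" using that by (simp add: e_def)
    have "v a \<ge> v p + (a - p) * (t - p)"
      using prox_subgradient[OF v, of t] by (auto simp: subdifferential_def p_def)
    then have va: "v a - e \<ge> v p - (p - a) * (t - a) + e"
      by (simp add: e_def power2_eq_square algebra_simps)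
    have "ereal (v a - e) < ereal (v a)" using e by simp
    also have "\<dots> \<le> liminf (\<lambda>k. ereal (vs k a))"
      using epi tendsto_const[of a sequentially] unfolding epi_converges_def by blast
    finally have "\<forall>\<^sub>F k in sequentially. ereal (v a - e) < ereal (vs k a)"
      by (rule less_LiminfD)
    moreover have "\<forall>\<^sub>F k in sequentially. vs k (q k) - (q k - a) * (t - a) < v p - (p - a) * (t - a) + e"
    proof (rule order_tendstoD(2))
      show "(\<lambda>k. vs k (q k) - (q k - a) * (t - a)) \<longlonglongrightarrow> v p - (p - a) * (t - a)"
        by (intro tendsto_intros q)
    qed (use e in simp)
    moreover have "\<forall>\<^sub>F k in sequentially. (q k - a) * (p - a) > 0"
    proof (rule order_tendstoD(1))
      show "(\<lambda>k. (q k - a) * (p - a)) \<longlonglongrightarrow> (p - a) * (p - a)"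
        by (intro tendsto_intros q)
    qed (use that in \<open>auto simp: zero_less_mult_iff\<close>)
    ultimately show ?thesis
    proof eventually_elim
      case (elim k)
      have "vs k (q k) < vs k a + (q k - a) * (t - a)" using elim va by simp
      then have "(prox (vs k) t - a) * (q k - a) > 0"
        using prox_between[OF vs, of k t a "q k"] by linarith
      then show ?case using elim(3) by (auto simp: zero_less_mult_iff)
    qed
  qed
  show ?thesis
  proof (rule order_tendstoI)
    fix a assume "a < prox v t"
    then show "\<forall>\<^sub>F k in sequentially. a < prox (vs k) t"
      using side[of a] by (auto simp: p_def zero_less_mult_iff elim!: eventually_mono)
  next
    fix a assume "a > prox v t"
    then show "\<forall>\<^sub>F k in sequentially. prox (vs k) t < a"
      using side[of a] by (auto simp: p_def zero_less_mult_iff elim!: eventually_mono)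
  qed
qed

lemma epi_continuous_integral_prox:
  assumes \<zeta>: "\<zeta> \<in> Cc" and v: "v \<in> Conv" and vs: "\<And>k. vs k \<in> Conv" and epi: "epi_converges vs v"
  shows "(\<lambda>k. \<integral>t. \<zeta> (prox (vs k) t) \<partial>lborel) \<longlonglongrightarrow> (\<integral>t. \<zeta> (prox v t) \<partial>lborel)"
proof -
  note lim = epi_converges_imp_prox_tendsto[OF v vs epi]
  obtain R M where RM: "R > 0" "\<And>x. \<bar>x\<bar> \<ge> R \<Longrightarrow> \<zeta> x = 0" "\<And>x. \<bar>\<zeta> x\<bar> \<le> M"
    using Cc_bounds[OF \<zeta>] by blast
  \<comment> \<open>The margin of one beyond \<open>R\<close> lets all but finitely many
    \<open>vs k\<close> share the window \<open>{\<alpha>..\<beta>}\<close>, hence one dominating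
    function.\<close>
  obtain \<alpha> \<beta> where ab: "prox v \<alpha> = - R - 1" "prox v \<beta> = R + 1"
    using prox_surj[OF v] by (metis surjD)
  have "\<forall>\<^sub>F k in sequentially. prox (vs k) \<alpha> < - R" "\<forall>\<^sub>F k in sequentially. R < prox (vs k) \<beta>"
    using order_tendstoD[OF lim[of \<alpha>]] order_tendstoD[OF lim[of \<beta>]] ab by auto
  then have "\<forall>\<^sub>F k in sequentially. prox (vs k) \<alpha> < - R \<and> R < prox (vs k) \<beta>"
    by (rule eventually_conj)
  then obtain N where N: "\<And>k. k \<ge> N \<Longrightarrow> prox (vs k) \<alpha> < - R \<and> R < prox (vs k) \<beta>"
    by (auto simp: eventually_sequentially)
  have cont: "isCont \<zeta> x" for x using \<zeta> by (simp add: Cc_def continuous_on_eq_continuous_at)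
  have "(\<lambda>k. \<integral>t. \<zeta> (prox (vs (k + N)) t) \<partial>lborel) \<longlonglongrightarrow> (\<integral>t. \<zeta> (prox v t) \<partial>lborel)"
  proof (rule integral_dominated_convergence[where w = "\<lambda>t. M * indicator {\<alpha>..\<beta>} t"])
    show "AE t in lborel. (\<lambda>k. \<zeta> (prox (vs (k + N)) t)) \<longlonglongrightarrow> \<zeta> (prox v t)"
      using LIMSEQ_ignore_initial_segment[OF lim] by (intro AE_I2 isCont_tendsto_compose[OF cont])
    show "AE t in lborel. norm (\<zeta> (prox (vs (k + N)) t)) \<le> M * indicator {\<alpha>..\<beta>} t" for k
      using N[of "k + N"] by (intro AE_I2 Cc_prox_bound[where R = R] vs RM) auto
    show "integrable lborel (\<lambda>t. M * indicator {\<alpha>..\<beta>} t :: real)"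
      by (intro integrable_mult_right integrable_real_indicator) (simp_all add: emeasure_lborel_Icc_eq)
  qed (use Cc_prox_measurable[OF \<zeta>] v vs in simp_all)
  then show ?thesis by (rule LIMSEQ_offset)
qed

subsection \<open>Valuations are determined by their values on hinge functions\<close>

definition hinge :: "real \<Rightarrow> real \<Rightarrow> real" where
  "hinge x z = max 0 (z - x)"

lemma Conv_cmult: "c \<ge> 0 \<Longrightarrow> v \<in> Conv \<Longrightarrow> (\<lambda>z. c * v z) \<in> Conv"
  by (simp add: Conv_def convex_on_cmul)

lemma Conv_hinge: "hinge x \<in> Conv"
  unfolding Conv_def mem_Collect_eq
proof (rule convex_onI)
  fix t a b :: real assume t: "t > 0" "t < 1"
  have "(1 - t) * (a - x) \<le> (1 - t) * max 0 (a - x)" "t * (b - x) \<le> t * max 0 (b - x)"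
    using t by (auto intro!: mult_left_mono)
  moreover have "(1 - t) * a + t * b - x = (1 - t) * (a - x) + t * (b - x)"
    by (simp add: algebra_simps)
  moreover have "0 \<le> (1 - t) * max 0 (a - x)" "0 \<le> t * max 0 (b - x)"
    using t by auto
  ultimately show "hinge x ((1 - t) *\<^sub>R a + t *\<^sub>R b) \<le> (1 - t) * hinge x a + t * hinge x b"
    unfolding hinge_def by simp
qed simp

lemma Conv_const: "(\<lambda>z. \<alpha>) \<in> Conv"
  using Conv_affine[of 0 \<alpha>] by simp

lemma Conv_cmult_hinge: "c \<ge> 0 \<Longrightarrow> (\<lambda>z. c * hinge x z) \<in> Conv"
  by (intro Conv_cmult Conv_hinge)

text \<open>The slopes in \<open>Conv_affine_below\<close> depend on three values only and converge,
  so the affine minorants at \<open>x\<close> control \<open>vs k (xs k)\<close> from below.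
  Constant sequences are recovery sequences.\<close>

lemma epi_converges_pointwise:
  assumes vs: "\<And>k. vs k \<in> Conv" and lim: "\<And>x. (\<lambda>k. vs k x) \<longlonglongrightarrow> v x"
  shows "epi_converges vs v"
  unfolding epi_converges_def
proof (intro allI conjI impI)
  fix x :: real and xs assume xs: "xs \<longlonglongrightarrow> x"
  define C where "C k = \<bar>vs k x - vs k (x - 1)\<bar> + \<bar>vs k (x + 1) - vs k x\<bar>" for k
  define l where "l k = vs k x - C k * \<bar>xs k - x\<bar>" for k
  have "l \<longlonglongrightarrow> v x - (\<bar>v x - v (x - 1)\<bar> + \<bar>v (x + 1) - v x\<bar>) * \<bar>x - x\<bar>"
    unfolding l_def C_def by (intro tendsto_intros lim xs)
  then have "(\<lambda>k. ereal (l k)) \<longlonglongrightarrow> ereal (v x)" by simp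
  then have "ereal (v x) = liminf (\<lambda>k. ereal (l k))"
    by (rule lim_imp_Liminf[OF trivial_limit_sequentially, symmetric])
  also have "\<dots> \<le> liminf (\<lambda>k. ereal (vs k (xs k)))"
    using Conv_affine_below[OF vs]
    by (intro Liminf_mono always_eventually allI) (simp add: l_def C_def)
  finally show "ereal (v x) \<le> liminf (\<lambda>k. ereal (vs k (xs k)))" .
next
  fix x
  show "\<exists>xs. xs \<longlonglongrightarrow> x \<and> (\<lambda>k. vs k (xs k)) \<longlonglongrightarrow> v x"
    using lim by (intro exI[of _ "\<lambda>_. x"]) simp
qed

locale dual_valuation =
  fixes Z :: "(real \<Rightarrow> real) \<Rightarrow> real"
  assumes epi_continuous: "epi_continuous_on Conv Z"
    and invariant: "dually_epi_translation_invariant Z"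
    and valuation: "valuation_on Conv Z"
begin

lemma tendsto_pointwise:
  assumes "v \<in> Conv" "\<And>k. vs k \<in> Conv" "\<And>x. (\<lambda>k. vs k x) \<longlonglongrightarrow> v x"
  shows "(\<lambda>k. Z (vs k)) \<longlonglongrightarrow> Z v"
  using epi_continuous epi_converges_pointwise[OF assms(2,3)] assms(1,2)
  unfolding epi_continuous_on_def by blast

lemma add_affine:
  assumes "v \<in> Conv"
  shows "Z (\<lambda>x. v x + (c * x + \<alpha>)) = Z v"
proof -
  have "linear (\<lambda>x::real. c * x)"
    by (simp add: linear_iff algebra_simps)
  then have "Z (\<lambda>x. v x + c * x) = Z v"
    using invariant assms unfolding dually_epi_translation_invariant_def by blast
  moreover have "(\<lambda>x. v x + c * x) \<in> Conv"
    using Conv_add[OF assms Conv_affine[of c 0]] by simp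
  then have "Z (\<lambda>x. v x + c * x + \<alpha>) = Z (\<lambda>x. v x + c * x)"
    by (rule invariant[unfolded dually_epi_translation_invariant_def, THEN conjunct2, rule_format])
  ultimately show ?thesis by (simp add: add.assoc)
qed

lemma affine: "Z (\<lambda>x. c * x + \<alpha>) = Z (\<lambda>x. 0)"
  using add_affine[OF Conv_const[of 0], of c \<alpha>] by simp

text \<open>The sum is the maximum of \<open>v\<close> and \<open>\<ell> + c * hinge x\<close>, and their minimum is
  \<open>\<ell>\<close>, where \<open>\<ell> z = \<beta> * z + \<alpha>\<close>.\<close>

lemma add_hinge:
  assumes v: "v \<in> Conv" and c: "c \<ge> 0"
    and above: "\<And>z. v z \<ge> \<beta> * z + \<alpha>" and right: "\<And>z. z \<ge> x \<Longrightarrow> v z = \<beta> * z + \<alpha>"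
  shows "Z (\<lambda>z. v z + c * hinge x z) + Z (\<lambda>z. 0) = Z v + Z (\<lambda>z. c * hinge x z)"
proof -
  define w where "w z = c * hinge x z + (\<beta> * z + \<alpha>)" for z
  have w: "w \<in> Conv"
    unfolding w_def by (intro Conv_add Conv_cmult_hinge Conv_affine c)
  have max: "max (v z) (w z) = v z + c * hinge x z" and min: "min (v z) (w z) = \<beta> * z + \<alpha>" for z
    using above[of z] right[of z] c by (cases "z \<ge> x"; simp add: w_def hinge_def)+
  have "(\<lambda>z. max (v z) (w z)) \<in> Conv" "(\<lambda>z. min (v z) (w z)) \<in> Conv"
    unfolding max min by (intro Conv_add Conv_cmult_hinge Conv_affine v c)+
  then have "Z (\<lambda>z. max (v z) (w z)) + Z (\<lambda>z. min (v z) (w z)) = Z v + Z w"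
    using valuation v w unfolding valuation_on_def by blast
  moreover have "Z w = Z (\<lambda>z. c * hinge x z)"
    unfolding w_def by (intro add_affine Conv_cmult_hinge c)
  ultimately show ?thesis unfolding max min affine by simp
qed

lemma cmult_hinge_add:
  assumes "c \<ge> 0" "d \<ge> 0"
  shows "Z (\<lambda>z. (c + d) * hinge x z) - Z (\<lambda>z. 0)
    = (Z (\<lambda>z. c * hinge x z) - Z (\<lambda>z. 0)) + (Z (\<lambda>z. d * hinge x z) - Z (\<lambda>z. 0))"
proof -
  have "c * hinge x z \<ge> c * z + - (c * x)" for z
    using mult_left_mono[OF _ assms(1), of "z - x" "hinge x z"] by (simp add: hinge_def algebra_simps)
  then have "Z (\<lambda>z. c * hinge x z + d * hinge x z) + Z (\<lambda>z. 0)
      = Z (\<lambda>z. c * hinge x z) + Z (\<lambda>z. d * hinge x z)"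
    using assms by (intro add_hinge[where \<beta> = c and \<alpha> = "- (c * x)"] Conv_cmult_hinge)
      (auto simp: hinge_def algebra_simps)
  then show ?thesis by (simp add: distrib_right)
qed

text \<open>Cauchy's functional equation: the map is additive by \<open>cmult_hinge_add\<close>,
  hence homogeneous over nonnegative rationals, and continuity of \<open>Z\<close> extends this to
  reals.\<close>

lemma cmult_hinge:
  assumes c: "c \<ge> 0"
  shows "Z (\<lambda>z. c * hinge x z) - Z (\<lambda>z. 0) = c * (Z (hinge x) - Z (\<lambda>z. 0))"
proof -
  define f where "f c = Z (\<lambda>z. c * hinge x z) - Z (\<lambda>z. 0)" for c
  have mult: "f (real n * d) = real n * f d" if "d \<ge> 0" for n d
  proof (induction n)
    case (Suc n)
    have "f (real (Suc n) * d) = f (real n * d + d)" by (simp add: algebra_simps)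
    also have "\<dots> = f (real n * d) + f d"
      unfolding f_def using that by (intro cmult_hinge_add) auto
    finally show ?case using Suc by (simp add: algebra_simps)
  qed (simp add: f_def)
  \<comment> \<open>Nonnegative rationals within \<open>1 / (n + 1)\<close> below
    \<open>c\<close>.\<close>
  define q where "q n = real (nat \<lfloor>c * real (Suc n)\<rfloor>) * (1 / real (Suc n))" for n
  have fq: "f (q n) = q n * f 1" for n
  proof -
    have "f 1 = real (Suc n) * f (1 / real (Suc n))"
      using mult[of "1 / real (Suc n)" "Suc n"] by simp
    then show ?thesis
      unfolding q_def by (subst mult) auto
  qed
  have q_nonneg: "q n \<ge> 0" for n by (simp add: q_def)
  have q: "q \<longlonglongrightarrow> c"
  proof (rule tendsto_sandwich)
    have fl: "c * real (Suc n) - 1 \<le> real (nat \<lfloor>c * real (Suc n)\<rfloor>)"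
      "real (nat \<lfloor>c * real (Suc n)\<rfloor>) \<le> c * real (Suc n)" for n
    proof -
      have "0 \<le> c * real (Suc n)" using c by simp
      then show "c * real (Suc n) - 1 \<le> real (nat \<lfloor>c * real (Suc n)\<rfloor>)"
        "real (nat \<lfloor>c * real (Suc n)\<rfloor>) \<le> c * real (Suc n)"
        by linarith+
    qed
    have "c - 1 / real (Suc n) = (c * real (Suc n) - 1) * (1 / real (Suc n))" for n
      by (simp add: field_simps)
    also have "(c * real (Suc n) - 1) * (1 / real (Suc n)) \<le> q n" for n
      unfolding q_def by (intro mult_right_mono fl) auto
    finally show "\<forall>\<^sub>F n in sequentially. c - 1 / real (Suc n) \<le> q n" by simp
    have "q n \<le> (c * real (Suc n)) * (1 / real (Suc n))" for n
      unfolding q_def by (intro mult_right_mono fl) auto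
    then show "\<forall>\<^sub>F n in sequentially. q n \<le> c" by simp
    show "(\<lambda>n. c - 1 / real (Suc n)) \<longlonglongrightarrow> c"
      using tendsto_diff[OF tendsto_const[of c] LIMSEQ_inverse_real_of_nat] by (simp add: inverse_eq_divide)
  qed auto
  have "(\<lambda>n. f (q n)) \<longlonglongrightarrow> f c"
    unfolding f_def using c q_nonneg
    by (intro tendsto_intros tendsto_pointwise Conv_cmult_hinge q) auto
  moreover have "(\<lambda>n. f (q n)) \<longlonglongrightarrow> c * f 1"
    unfolding fq by (intro tendsto_intros q)
  ultimately have "f c = c * f 1" by (rule LIMSEQ_unique)
  then show ?thesis by (simp add: f_def)
qed

text \<open>Kinks are added from left to right, so that at each step the partial sum is already
  affine beyond the new kink, as \<open>add_hinge\<close> requires.\<close>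

lemma sum_hinge:
  assumes c: "\<And>i. c i \<ge> 0" and x: "mono (x :: nat \<Rightarrow> real)"
  shows "Z (\<lambda>z. \<beta> * z + \<alpha> + (\<Sum>i<n. c i * hinge (x i) z))
    = Z (\<lambda>z. 0) + (\<Sum>i<n. c i * (Z (hinge (x i)) - Z (\<lambda>z. 0)))"
proof (induction n)
  case 0
  then show ?case by (simp add: affine)
next
  case (Suc n)
  let ?v = "\<lambda>z. \<beta> * z + \<alpha> + (\<Sum>i<n. c i * hinge (x i) z)"
  have v: "?v \<in> Conv"
  proof (induction n)
    case (Suc n)
    then show ?case
      using Conv_add[OF Suc Conv_cmult_hinge[OF c[of n], of "x n"]] by (simp add: add.assoc)
  qed (simp add: Conv_affine)
  \<comment> \<open>The affine function with which the partial sum coincides from \<open>x n\<close>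
    on; elsewhere it lies below, as every hinge dominates its slanted line.\<close>
  have l: "(\<beta> + (\<Sum>i<n. c i)) * z + (\<alpha> - (\<Sum>i<n. c i * x i))
      = \<beta> * z + \<alpha> + (\<Sum>i<n. c i * (z - x i))" for z
    by (simp add: algebra_simps sum_distrib_left sum_subtractf)
  have "Z (\<lambda>z. ?v z + c n * hinge (x n) z) + Z (\<lambda>z. 0) = Z ?v + Z (\<lambda>z. c n * hinge (x n) z)"
  proof (rule add_hinge[OF v c, where \<beta> = "\<beta> + (\<Sum>i<n. c i)" and \<alpha> = "\<alpha> - (\<Sum>i<n. c i * x i)"])
    show "(\<beta> + (\<Sum>i<n. c i)) * z + (\<alpha> - (\<Sum>i<n. c i * x i)) \<le> ?v z" for z
      unfolding l using c by (auto intro!: sum_mono mult_left_mono simp: hinge_def)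
    show "?v z = (\<beta> + (\<Sum>i<n. c i)) * z + (\<alpha> - (\<Sum>i<n. c i * x i))" if "z \<ge> x n" for z
    proof -
      have "hinge (x i) z = z - x i" if "i < n" for i
        using monoD[OF x, of i n] that \<open>z \<ge> x n\<close> by (simp add: hinge_def)
      then show ?thesis unfolding l by simp
    qed
  qed
  then have "Z (\<lambda>z. ?v z + c n * hinge (x n) z) = Z ?v + c n * (Z (hinge (x n)) - Z (\<lambda>z. 0))"
    using cmult_hinge[OF c[of n], of "x n"] by simp
  then show ?case using Suc by (simp add: add.assoc)
qed

end

subsection \<open>Piecewise affine interpolation\<close>

text \<open>Piecewise affine interpolation of \<open>v\<close> at the nodes \<open>a + h * i\<close>
  for \<open>i \<le> n + 1\<close>, continued affinely outside. It is written with hinges at the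
  \<open>n\<close> inner nodes, weighted by the slope changes, so that \<open>sum_hinge\<close>
  applies.\<close>

definition interpolant :: "(real \<Rightarrow> real) \<Rightarrow> real \<Rightarrow> real \<Rightarrow> nat \<Rightarrow> real \<Rightarrow> real" where
  "interpolant v a h n z = v a + (v (a + h) - v a) / h * (z - a)
    + (\<Sum>i<n. (v (a + h * (real i + 2)) - 2 * v (a + h * (real i + 1)) + v (a + h * real i)) / h
        * hinge (a + h * (real i + 1)) z)"

lemma second_difference_nonneg:
  assumes "v \<in> Conv" "h > 0"
  shows "0 \<le> (v (a + h * (i + 2)) - 2 * v (a + h * (i + 1)) + v (a + h * i)) / h"
proof -
  have "a + h * (i + 1) = (1 - 1 / 2) *\<^sub>R (a + h * i) + (1 / 2) *\<^sub>R (a + h * (i + 2))"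
    by (simp add: field_simps)
  then have "v (a + h * (i + 1)) \<le> (1 - 1 / 2) * v (a + h * i) + 1 / 2 * v (a + h * (i + 2))"
    using convex_onD[of UNIV v "1 / 2" "a + h * i" "a + h * (i + 2)"] assms(1) by (simp add: Conv_def)
  then show ?thesis using assms(2) by simp
qed

text \<open>Each further hinge turns the slope of one chord into that of the next.\<close>

lemma interpolant_last_piece:
  assumes h: "h > 0" and "z \<ge> a + h * real n"
  shows "interpolant v a h n z
    = v (a + h * n) + (v (a + h * (real n + 1)) - v (a + h * n)) / h * (z - (a + h * n))"
  using assms(2)
proof (induction n)
  case 0
  then show ?case by (simp add: interpolant_def)
next
  case (Suc n)
  have "a + h * real n \<le> a + h * real (Suc n)" using h by simp
  then have IH: "interpolant v a h n z
    = v (a + h * n) + (v (a + h * (real n + 1)) - v (a + h * n)) / h * (z - (a + h * n))"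
    using Suc by linarith
  have "interpolant v a h (Suc n) z = interpolant v a h n z
      + (v (a + h * (real n + 2)) - 2 * v (a + h * (real n + 1)) + v (a + h * n)) / h * (z - (a + h * (real n + 1)))"
    using Suc.prems by (simp add: interpolant_def hinge_def max_def add.commute)
  moreover have "A + (B - A) / h * (z - x) + (D - 2 * B + A) / h * (z - (x + h))
      = B + (D - B) / h * (z - (x + h))" for A B D x
    using h by (simp add: field_simps)
  moreover have "a + h * (real n + 1) = a + h * real n + h" by (simp add: algebra_simps)
  moreover have "real (Suc n) = real n + 1" "real (Suc n) + 1 = real n + 2" by simp_all
  ultimately show ?case by (simp only: IH)
qed

text \<open>Hinges at later nodes vanish on this cell, so only the first \<open>j\<close> of them
  count.\<close>

lemma interpolant_piece:
  assumes h: "h > 0" and j: "j \<le> n" and z: "a + h * real j \<le> z" "z \<le> a + h * real (Suc j)"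
  shows "interpolant v a h n z
    = v (a + h * j) + (v (a + h * (real j + 1)) - v (a + h * j)) / h * (z - (a + h * j))"
proof -
  have "interpolant v a h n z = interpolant v a h j z"
    using j
  proof (induction n rule: dec_induct)
    case (step m)
    have "h * real (Suc j) \<le> h * real (Suc m)" using h step by (intro mult_left_mono) auto
    then have "hinge (a + h * (real m + 1)) z = 0" using z by (simp add: hinge_def algebra_simps)
    then show ?case using step by (simp add: interpolant_def)
  qed simp
  then show ?thesis using interpolant_last_piece[OF h z(1)] by simp
qed

text \<open>On a cell the interpolant is a convex combination of the values of \<open>v\<close> at
  the two end nodes, both within \<open>h\<close> of \<open>z\<close>.\<close>

lemma interpolant_close:
  assumes h: "h > 0" and j: "j \<le> n" and z: "a + h * real j \<le> z" "z \<le> a + h * real (Suc j)"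
    and close: "\<And>w. \<bar>w - z\<bar> \<le> h \<Longrightarrow> \<bar>v w - v z\<bar> \<le> e"
  shows "\<bar>interpolant v a h n z - v z\<bar> \<le> e"
proof -
  define l where "l = (z - (a + h * j)) / h"
  have l: "0 \<le> l" "l \<le> 1" using z h by (auto simp: l_def field_simps)
  have "interpolant v a h n z - v z = (1 - l) * (v (a + h * j) - v z) + l * (v (a + h * (real j + 1)) - v z)"
    unfolding interpolant_piece[OF assms(1-4)] l_def using h by (simp add: field_simps)
  also have "\<bar>\<dots>\<bar> \<le> (1 - l) * \<bar>v (a + h * j) - v z\<bar> + l * \<bar>v (a + h * (real j + 1)) - v z\<bar>"
    using l by (intro order_trans[OF abs_triangle_ineq]) (simp add: abs_mult)
  also have "\<dots> \<le> (1 - l) * e + l * e"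
    using l z h by (intro add_mono mult_left_mono close) (auto simp: algebra_simps)
  finally show ?thesis by (simp add: algebra_simps)
qed

lemma interpolant_tendsto:
  assumes v: "v \<in> Conv"
  shows "(\<lambda>k. interpolant v (- real k) (1 / real (Suc k)) (2 * k * Suc k) z) \<longlonglongrightarrow> v z"
proof (rule LIMSEQ_I)
  fix e :: real assume e: "e > 0"
  have "isCont v z" using Conv_continuous[OF v] by (simp add: continuous_on_eq_continuous_at)
  then obtain d where d: "d > 0" "\<And>w. \<bar>w - z\<bar> < d \<Longrightarrow> \<bar>v w - v z\<bar> < e / 2"
    using e unfolding continuous_at_eps_delta dist_real_def by (metis half_gt_zero)
  obtain K1 :: nat where K1: "1 / d < real K1" using reals_Archimedean2 by blast
  obtain K2 :: nat where K2: "\<bar>z\<bar> < real K2" using reals_Archimedean2 by blast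
  show "\<exists>K. \<forall>k\<ge>K. norm (interpolant v (- real k) (1 / real (Suc k)) (2 * k * Suc k) z - v z) < e"
  proof (intro exI[of _ "max K1 K2"] allI impI)
    fix k assume k: "k \<ge> max K1 K2"
    define h where "h = 1 / real (Suc k)"
    have h: "h > 0" by (simp add: h_def)
    have "1 / d < real (Suc k)" using K1 k by linarith
    then have hd: "h < d" using d(1) by (simp add: h_def field_simps)
    have zk: "\<bar>z\<bar> < real k" using K2 k by linarith
    \<comment> \<open>The index of the cell containing \<open>z\<close>. The grid starts at
      \<open>-k\<close> with mesh \<open>1 / (k + 1)\<close>, so \<open>2 * k * (k + 1)\<close>
      kinks reach \<open>k\<close>.\<close>
    define j where "j = nat \<lfloor>(z + real k) * real (Suc k)\<rfloor>"
    have fl: "real j \<le> (z + real k) * real (Suc k)" "(z + real k) * real (Suc k) \<le> real (Suc j)"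
      using zk unfolding j_def by (auto intro!: of_nat_floor) linarith
    have "(z + real k) * real (Suc k) \<le> (2 * real k) * real (Suc k)"
      using zk by (intro mult_right_mono) auto
    then have "real j \<le> (2 * real k) * real (Suc k)" using fl by linarith
    also have "\<dots> = real (2 * k * Suc k)" by (simp add: algebra_simps)
    finally have "real j \<le> real (2 * k * Suc k)" .
    then have "j \<le> 2 * k * Suc k" by (simp only: of_nat_le_iff)
    moreover have "- real k + h * real j \<le> z" "z \<le> - real k + h * real (Suc j)"
      using fl pos_divide_le_eq[of "real (Suc k)" "real j" "z + real k"]
        pos_le_divide_eq[of "real (Suc k)" "z + real k" "real (Suc j)"]
      by (simp_all add: h_def)
    ultimately have "\<bar>interpolant v (- real k) h (2 * k * Suc k) z - v z\<bar> \<le> e / 2"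
      using d(2) hd by (intro interpolant_close[OF h]) (auto intro: less_imp_le)
    then show "norm (interpolant v (- real k) (1 / real (Suc k)) (2 * k * Suc k) z - v z) < e"
      using e by (simp add: h_def)
  qed
qed

lemma (in dual_valuation) Z_interpolant:
  assumes v: "v \<in> Conv" and h: "h > 0"
  shows "Z (interpolant v a h n) = Z (\<lambda>z. 0)
    + (\<Sum>i<n. (v (a + h * (real i + 2)) - 2 * v (a + h * (real i + 1)) + v (a + h * real i)) / h
        * (Z (hinge (a + h * (real i + 1))) - Z (\<lambda>z. 0)))"
proof -
  define \<beta> where "\<beta> = (v (a + h) - v a) / h"
  define x where "x i = a + h * (real i + 1)" for i
  define c where "c i = (v (a + h * (real i + 2)) - 2 * v (a + h * (real i + 1)) + v (a + h * real i)) / h" for i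
  have "mono x" using h by (auto simp: mono_def x_def)
  moreover have "c i \<ge> 0" for i unfolding c_def by (rule second_difference_nonneg[OF v h])
  ultimately have "Z (\<lambda>z. \<beta> * z + (v a - \<beta> * a) + (\<Sum>i<n. c i * hinge (x i) z))
      = Z (\<lambda>z. 0) + (\<Sum>i<n. c i * (Z (hinge (x i)) - Z (\<lambda>z. 0)))"
    by (intro sum_hinge)
  moreover have "interpolant v a h n = (\<lambda>z. \<beta> * z + (v a - \<beta> * a) + (\<Sum>i<n. c i * hinge (x i) z))"
    by (simp add: interpolant_def fun_eq_iff \<beta>_def c_def x_def right_diff_distrib)
  ultimately show ?thesis by (simp only: c_def x_def)
qed

lemma Conv_interpolant:
  assumes v: "v \<in> Conv" and h: "h > 0"
  shows "interpolant v a h n \<in> Conv"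
proof (induction n)
  case 0
  have "interpolant v a h 0 = (\<lambda>z. (v (a + h) - v a) / h * z + (v a - (v (a + h) - v a) / h * a))"
    by (simp add: interpolant_def fun_eq_iff right_diff_distrib)
  then show ?case by (simp only: Conv_affine)
next
  case (Suc n)
  show ?case
    using Conv_add[OF Suc Conv_cmult_hinge[OF second_difference_nonneg[OF v h, of a "real n"], of "a + h * (real n + 1)"]]
    by (simp add: interpolant_def[abs_def] add.assoc)
qed

lemma dual_valuation_eqI:
  assumes Z: "dual_valuation Z" and W: "dual_valuation W"
    and "Z (\<lambda>z. 0) = W (\<lambda>z. 0)" "\<And>x. Z (hinge x) = W (hinge x)" and v: "v \<in> Conv"
  shows "Z v = W v"
proof (rule LIMSEQ_unique)
  let ?I = "\<lambda>k. interpolant v (- real k) (1 / real (Suc k)) (2 * k * Suc k)"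
  show "(\<lambda>k. Z (?I k)) \<longlonglongrightarrow> Z v"
    by (intro dual_valuation.tendsto_pointwise[OF Z v] Conv_interpolant v interpolant_tendsto) simp
  have "Z (?I k) = W (?I k)" for k
    using assms(3,4) v by (simp add: dual_valuation.Z_interpolant[OF Z] dual_valuation.Z_interpolant[OF W])
  then show "(\<lambda>k. Z (?I k)) \<longlonglongrightarrow> W v"
    using dual_valuation.tendsto_pointwise[OF W v, of ?I] Conv_interpolant[OF v] interpolant_tendsto[OF v]
    by simp
qed

subsection \<open>The classification\<close>

lemma (in dual_valuation) hinge_density_Cc:
  "(\<lambda>x. Z (hinge x) - Z (\<lambda>z. 0)) \<in> Cc"
proof -
  let ?\<zeta> = "\<lambda>x. Z (hinge x) - Z (\<lambda>z. 0)"
  have "continuous_on UNIV ?\<zeta>"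
  proof (intro continuous_on_sequentiallyI tendsto_intros)
    fix u :: "nat \<Rightarrow> real" and a assume "u \<longlonglongrightarrow> a"
    then show "(\<lambda>n. Z (hinge (u n))) \<longlonglongrightarrow> Z (hinge a)"
      unfolding hinge_def[abs_def]
      by (intro tendsto_pointwise Conv_hinge[unfolded hinge_def[abs_def]] tendsto_intros)
  qed
  moreover have "bounded {x. ?\<zeta> x \<noteq> 0}"
  proof (rule ccontr)
    assume "\<not> bounded {x. ?\<zeta> x \<noteq> 0}"
    then have "\<exists>x. ?\<zeta> x \<noteq> 0 \<and> real n < \<bar>x\<bar>" for n :: nat
      unfolding bounded_iff by (force simp: not_le)
    then obtain x where x: "\<And>n. ?\<zeta> (x n) \<noteq> 0" "\<And>n. real n < \<bar>x n\<bar>" by metis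
    \<comment> \<open>Normalizes the rescaled hinges so that their values under \<open>Z\<close>
      stay at distance exactly one from the value at \<open>0\<close>.\<close>
    define c where "c n = 1 / \<bar>?\<zeta> (x n)\<bar>" for n
    have c: "c n \<ge> 0" for n by (simp add: c_def)
    \<comment> \<open>A hinge with kink far to the left is affine, not zero, near a given
      \<open>z\<close>; subtracting its slanted line leaves a function supported to the left of
      \<open>x n\<close>.\<close>
    define b where "b n = (if x n < 0 then c n else 0)" for n
    define w where "w n z = c n * hinge (x n) z + (- b n * z + b n * x n)" for n z
    have w: "w n \<in> Conv" for n
      unfolding w_def by (intro Conv_add Conv_cmult_hinge Conv_affine c)
    have "\<bar>Z (w n) - Z (\<lambda>z. 0)\<bar> = 1" for n
    proof -
      have "Z (w n) = Z (\<lambda>z. c n * hinge (x n) z)"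
        unfolding w_def by (intro add_affine Conv_cmult_hinge c)
      then have "Z (w n) - Z (\<lambda>z. 0) = c n * ?\<zeta> (x n)" using cmult_hinge[OF c] by simp
      then show ?thesis using x(1)[of n] by (simp add: c_def abs_mult)
    qed
    moreover have "(\<lambda>n. Z (w n)) \<longlonglongrightarrow> Z (\<lambda>z. 0)"
    proof (rule tendsto_pointwise[OF Conv_const w])
      fix z
      obtain N :: nat where N: "\<bar>z\<bar> < real N" using reals_Archimedean2 by blast
      have "w n z = 0" if "n \<ge> N" for n
      proof -
        have "\<bar>z\<bar> < \<bar>x n\<bar>" using x(2)[of n] N that by linarith
        then show ?thesis by (cases "x n < 0") (auto simp: w_def b_def hinge_def algebra_simps)
      qed
      then show "(\<lambda>n. w n z) \<longlonglongrightarrow> 0"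
        by (intro tendsto_eventually) (auto simp: eventually_sequentially)
    qed
    then have "(\<lambda>n. \<bar>Z (w n) - Z (\<lambda>z. 0)\<bar>) \<longlonglongrightarrow> \<bar>Z (\<lambda>z. 0) - Z (\<lambda>z. 0)\<bar>"
      by (intro tendsto_intros)
    ultimately show False by (simp add: LIMSEQ_const_iff)
  qed
  ultimately show ?thesis by (simp add: Cc_def compact_closure)
qed

lemma dual_valuation_integral:
  assumes \<zeta>: "\<zeta> \<in> Cc"
    and Z: "\<And>v. v \<in> Conv \<Longrightarrow> Z v = \<zeta>0 + (\<integral>(x, y). \<zeta> x \<partial>hessian_measure0 v)"
  shows "dual_valuation Z"
proof
  define I where "I v = (\<integral>t. \<zeta> (prox v t) \<partial>lborel)" for v
  have ZI: "Z v = \<zeta>0 - (\<integral>x. \<zeta> x \<partial>lborel) + I v" if "v \<in> Conv" for v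
    using Z[OF that] integral_hessian_measure0[OF \<zeta> that] by (simp add: I_def)
  show "epi_continuous_on Conv Z"
    unfolding epi_continuous_on_def
  proof (intro allI ballI impI)
    fix vs v assume v: "v \<in> Conv" and vs: "\<forall>k. vs k \<in> Conv" and epi: "epi_converges vs v"
    have "(\<lambda>k. I (vs k)) \<longlonglongrightarrow> I v"
      unfolding I_def using vs by (intro epi_continuous_integral_prox \<zeta> v epi) auto
    then have "(\<lambda>k. \<zeta>0 - (\<integral>x. \<zeta> x \<partial>lborel) + I (vs k)) \<longlonglongrightarrow> \<zeta>0 - (\<integral>x. \<zeta> x \<partial>lborel) + I v"
      by (intro tendsto_intros)
    then show "(\<lambda>k. Z (vs k)) \<longlonglongrightarrow> Z v" using ZI v vs by simp
  qed
  have aff: "Z (\<lambda>x. v x + (c * x + \<alpha>)) = Z v" if v: "v \<in> Conv" for v c \<alpha>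
  proof -
    \<comment> \<open>The affine summand shifts the proximal map, and Lebesgue measure is
      translation invariant.\<close>
    have "I (\<lambda>x. v x + (c * x + \<alpha>)) = (\<integral>t. \<zeta> (prox v (- c + 1 * t)) \<partial>lborel)"
      unfolding I_def prox_add_affine[OF v] by simp
    also have "\<dots> = I v"
      unfolding I_def using lborel_integral_real_affine[of 1 "\<lambda>t. \<zeta> (prox v t)" "- c"] by simp
    finally show ?thesis using ZI[OF v] ZI[OF Conv_add[OF v Conv_affine]] by simp
  qed
  show "dually_epi_translation_invariant Z"
    unfolding dually_epi_translation_invariant_def
  proof (intro conjI ballI allI impI)
    fix v and l :: "real \<Rightarrow> real" assume v: "v \<in> Conv" and l: "linear l"
    have "(\<lambda>x. v x + l x) = (\<lambda>x. v x + (l 1 * x + 0))"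
      using linear_scale[OF l, of _ 1] by (intro ext) (metis add_0_right mult.commute mult.right_neutral real_scaleR_def)
    then show "Z (\<lambda>x. v x + l x) = Z v" by (simp only: aff[OF v])
  next
    fix v :: "real \<Rightarrow> real" and \<alpha> assume "v \<in> Conv"
    then show "Z (\<lambda>x. v x + \<alpha>) = Z v" using aff[of v 0 \<alpha>] by simp
  qed
  show "valuation_on Conv Z"
    unfolding valuation_on_def
  proof (intro ballI impI)
    fix u v assume uv: "u \<in> Conv" "v \<in> Conv"
      "(\<lambda>x. max (u x) (v x)) \<in> Conv" "(\<lambda>x. min (u x) (v x)) \<in> Conv"
    have "I (\<lambda>x. max (u x) (v x)) + I (\<lambda>x. min (u x) (v x)) = I u + I v"
      unfolding I_def using uv integrable_Cc_prox[OF \<zeta>]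
      by (simp add: prox_valuation flip: Bochner_Integration.integral_add)
    then show "Z (\<lambda>x. max (u x) (v x)) + Z (\<lambda>x. min (u x) (v x)) = Z u + Z v"
      using ZI uv by simp
  qed
qed

section \<open>Hessian integrals of zero and of hinges\<close>

lemma prox_hinge: "prox (hinge x) t = (if t \<le> x then t else if t \<le> x + 1 then x else t - 1)"
proof (rule prox_eqI)
  have "(z - x) * (t - x) \<le> max 0 (z - x)" if "x < t" "t \<le> x + 1" for z
    using mult_left_mono[of "t - x" 1 "z - x"] mult_nonpos_nonneg[of "z - x" "t - x"] that
    by (cases "z \<ge> x") auto
  then show "t - (if t \<le> x then t else if t \<le> x + 1 then x else t - 1)
      \<in> subdifferential (hinge x) (if t \<le> x then t else if t \<le> x + 1 then x else t - 1)"
    by (auto simp: subdifferential_def hinge_def)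
qed

lemma prox_zero: "prox (\<lambda>z. 0) t = t"
  by (rule prox_eqI) (simp add: subdifferential_def)

lemma integral_hessian_measure0_zero:
  "\<zeta> \<in> Cc \<Longrightarrow> (\<integral>(x, y). \<zeta> x \<partial>hessian_measure0 (\<lambda>z. 0)) = 0"
  by (simp add: integral_hessian_measure0 Conv_const prox_zero)

text \<open>The proximal map of the hinge stays at \<open>x\<close> on a parameter interval of
  length one, which contributes \<open>\<zeta> x\<close>. The remaining two pieces, one of them
  translated by one, reassemble to the integral of \<open>\<zeta>\<close>.\<close>

lemma integral_hessian_measure0_hinge:
  assumes \<zeta>: "\<zeta> \<in> Cc"
  shows "(\<integral>(y, _). \<zeta> y \<partial>hessian_measure0 (hinge x)) = \<zeta> x"
proof -
  have int: "integrable lborel \<zeta>"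
    using integrable_Cc_prox[OF \<zeta> Conv_const[of 0]] by (simp add: prox_zero)
  let ?l = "\<lambda>t. indicator {..x} t * \<zeta> t" and ?r = "\<lambda>t. indicator {x<..} t * \<zeta> t"
  have il: "integrable lborel ?l" and ir: "integrable lborel ?r"
    using int by (auto intro!: integrable_real_mult_indicator simp: mult.commute)
  have ir': "integrable lborel (\<lambda>t. ?r (- 1 + 1 * t))"
    using lborel_integrable_real_affine[OF ir, of 1 "- 1"] by simp
  have "(\<integral>t. \<zeta> (prox (hinge x) t) \<partial>lborel)
      = (\<integral>t. ?l t + ?r (- 1 + 1 * t) + \<zeta> x * indicator {x<..x + 1} t \<partial>lborel)"
    by (intro Bochner_Integration.integral_cong) (auto simp: prox_hinge indicator_def)
  also have "\<dots> = (\<integral>t. ?l t \<partial>lborel) + (\<integral>t. ?r (- 1 + 1 * t) \<partial>lborel) + \<zeta> x"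
    using il ir' by simp
  also have "(\<integral>t. ?r (- 1 + 1 * t) \<partial>lborel) = (\<integral>t. ?r t \<partial>lborel)"
    using lborel_integral_real_affine[of 1 ?r "- 1"] by simp
  also have "(\<integral>t. ?l t \<partial>lborel) + (\<integral>t. ?r t \<partial>lborel) = (\<integral>t. ?l t + ?r t \<partial>lborel)"
    using il ir by simp
  also have "\<dots> = (\<integral>t. \<zeta> t \<partial>lborel)"
    by (intro Bochner_Integration.integral_cong) (auto simp: indicator_def)
  finally show ?thesis
    using integral_hessian_measure0[OF \<zeta> Conv_hinge, of x] by simp
qed

theorem corollary6:
  fixes Z :: "(real \<Rightarrow> real) \<Rightarrow> real"
  shows "(epi_continuous_on Conv Z \<and> dually_epi_translation_invariant Z \<and> valuation_on Conv Z) \<longleftrightarrow>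
    (\<exists>\<zeta>0::real. \<exists>\<zeta>1\<in>Cc. \<forall>v\<in>Conv.
       Z v = \<zeta>0 + (\<integral>(x, y). \<zeta>1 x \<partial>hessian_measure0 v))"
proof
  assume "epi_continuous_on Conv Z \<and> dually_epi_translation_invariant Z \<and> valuation_on Conv Z"
  then have Z: "dual_valuation Z" by (simp add: dual_valuation_def)
  define \<zeta> where "\<zeta> x = Z (hinge x) - Z (\<lambda>z. 0)" for x
  have \<zeta>: "\<zeta> \<in> Cc"
    using dual_valuation.hinge_density_Cc[OF Z] by (simp add: \<zeta>_def[abs_def])
  \<comment> \<open>The integral functional is itself a functional of the same kind, so agreement
    with \<open>Z\<close> at \<open>0\<close> and at the hinges suffices.\<close>
  define W where "W v = Z (\<lambda>z. 0) + (\<integral>(x, y). \<zeta> x \<partial>hessian_measure0 v)" for v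
  have W: "dual_valuation W"
    by (rule dual_valuation_integral[OF \<zeta>]) (rule W_def)
  have "Z (\<lambda>z. 0) = W (\<lambda>z. 0)"
    unfolding W_def integral_hessian_measure0_zero[OF \<zeta>] by simp
  moreover have "Z (hinge x) = W (hinge x)" for x
    unfolding W_def integral_hessian_measure0_hinge[OF \<zeta>] by (simp add: \<zeta>_def)
  ultimately have "Z v = W v" if "v \<in> Conv" for v
    using that by (rule dual_valuation_eqI[OF Z W])
  then show "\<exists>\<zeta>0. \<exists>\<zeta>1\<in>Cc. \<forall>v\<in>Conv. Z v = \<zeta>0 + (\<integral>(x, y). \<zeta>1 x \<partial>hessian_measure0 v)"
    unfolding W_def by (intro exI[of _ "Z (\<lambda>z. 0)"] bexI[OF _ \<zeta>] ballI)
next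
  assume "\<exists>\<zeta>0. \<exists>\<zeta>1\<in>Cc. \<forall>v\<in>Conv. Z v = \<zeta>0 + (\<integral>(x, y). \<zeta>1 x \<partial>hessian_measure0 v)"
  then have "dual_valuation Z" using dual_valuation_integral by blast
  then show "epi_continuous_on Conv Z \<and> dually_epi_translation_invariant Z \<and> valuation_on Conv Z"
    by (simp add: dual_valuation_def)
qed

end
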